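(* There exists an absolute constant $c>0$ such that for all $k\ge 3$ and all $m=m(n)$ with $m/n\geq c\,2^k\ln^2 k/k$ the following holds with high probability (i.e. with probability $1-o(1)$ as $n\to\infty$) over the random formula $\Phi=\Phi_k(n,m)$: $$\mathrm{suc}\big(\Phi,\lceil \exp(n/k^2)\rceil\big)\leq \exp(-n/k^2).$$
   Context: For integers $k\ge 3$ and $n,m>0$, $\Phi=\Phi_k(n,m)=\Phi_1\wedge\cdots\wedge\Phi_m$ is a random $k$-CNF on the Boolean variables $x_1,\dots,x_n$ whose clauses $\Phi_i=\Phi_{i1}\vee\cdots\vee\Phi_{ik}$ consist of $k$ literals; it is chosen uniformly at random from all $(2n)^{km}$ such formulas. For an assignment $\sigma\in\{0,1\}^n$, $U_\Phi(\sigma)$ is the set of indices $i\in[m]$ such that $\Phi_i$ is unsatisfied under $\sigma$. The algorithm Walksat$(\Phi,\omega)$ (with $\omega$ a positive integer) works as follows: choose $\sigma^{[0]}\in\{0,1\}^n$ uniformly at random; for $i=0,\dots,\omega$: if $\sigma^{[i]}$ satisfies $\Phi$, output it and halt; otherwise choose $i'\in U_\Phi(\sigma^{[i]})$ and $j\in[k]$ uniformly at random (independently) and obtain $\sigma^{[i+1]}$ from $\sigma^{[i]}$ by flipping the value of the variable underlying the literal $\Phi_{i'j}$. If no satisfying assignment is found, output failure. $\mathrm{suc}(\Phi,\omega)$ denotes the probability, over the random choices of the algorithm only (for fixed $\Phi$), that Walksat$(\Phi,\omega)$ finds a satisfying assignment. *)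

theory Defs
  imports "HOL-Analysis.Analysis"
begin

text \<open>Variables are 0,...,n-1. A literal is a pair (v, s): s = True means the
positive literal x_v, s = False the negative literal. A formula with m clauses
of k literals is a function Phi with Phi i j the j-th literal of clause i
(i < m, j < k), extensional outside this range.\<close>

type_synonym lit = "nat \<times> bool"
type_synonym cnf = "nat \<Rightarrow> nat \<Rightarrow> lit"
type_synonym assignment = "nat \<Rightarrow> bool"

definition formulas :: "nat \<Rightarrow> nat \<Rightarrow> nat \<Rightarrow> cnf set" where
  "formulas n k m = PiE {..<m} (\<lambda>_. PiE {..<k} (\<lambda>_. {..<n} \<times> (UNIV :: bool set)))"

definition assignments :: "nat \<Rightarrow> assignment set" where
  "assignments n = PiE {..<n} (\<lambda>_. UNIV :: bool set)"

definition lit_sat :: "assignment \<Rightarrow> lit \<Rightarrow> bool" where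
  "lit_sat \<sigma> l = (\<sigma> (fst l) = snd l)"

definition clause_sat :: "nat \<Rightarrow> cnf \<Rightarrow> assignment \<Rightarrow> nat \<Rightarrow> bool" where
  "clause_sat k \<Phi> \<sigma> i = (\<exists>j<k. lit_sat \<sigma> (\<Phi> i j))"

definition unsat_clauses :: "nat \<Rightarrow> nat \<Rightarrow> cnf \<Rightarrow> assignment \<Rightarrow> nat set" where
  "unsat_clauses k m \<Phi> \<sigma> = {i. i < m \<and> \<not> clause_sat k \<Phi> \<sigma> i}"

definition satisfies :: "nat \<Rightarrow> nat \<Rightarrow> cnf \<Rightarrow> assignment \<Rightarrow> bool" where
  "satisfies k m \<Phi> \<sigma> = (\<forall>i<m. clause_sat k \<Phi> \<sigma> i)"

definition flip :: "assignment \<Rightarrow> nat \<Rightarrow> assignment" where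
  "flip \<sigma> v = \<sigma>(v := \<not> \<sigma> v)"

text \<open>walk_succ k m Phi sigma r: probability that Walksat, currently at sigma with
iterations i = t, ..., t + r still to perform (i.e. r+1 more satisfiability checks),
finds a satisfying assignment.\<close>

fun walk_succ :: "nat \<Rightarrow> nat \<Rightarrow> cnf \<Rightarrow> assignment \<Rightarrow> nat \<Rightarrow> real" where
  "walk_succ k m \<Phi> \<sigma> 0 = (if satisfies k m \<Phi> \<sigma> then 1 else 0)"
| "walk_succ k m \<Phi> \<sigma> (Suc r) =
     (if satisfies k m \<Phi> \<sigma> then 1
      else (\<Sum>i\<in>unsat_clauses k m \<Phi> \<sigma>. \<Sum>j<k.
               walk_succ k m \<Phi> (flip \<sigma> (fst (\<Phi> i j))) r)
           / (real (card (unsat_clauses k m \<Phi> \<sigma>)) * real k))"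

text \<open>suc(Phi, omega): loop i = 0..omega, uniformly random start in {0,1}^n.\<close>
definition suc :: "nat \<Rightarrow> nat \<Rightarrow> nat \<Rightarrow> cnf \<Rightarrow> nat \<Rightarrow> real" where
  "suc n k m \<Phi> \<omega> = (\<Sum>\<sigma>\<in>assignments n. walk_succ k m \<Phi> \<sigma> \<omega>) / 2 ^ n"

definition formula_prob :: "nat \<Rightarrow> nat \<Rightarrow> nat \<Rightarrow> (cnf \<Rightarrow> bool) \<Rightarrow> real" where
  "formula_prob n k m P = real (card {\<Phi> \<in> formulas n k m. P \<Phi>}) / real (card (formulas n k m))"

end

(* Write mu = m / 2^k for the mean number of clauses falsified by an assignment and call an assignment
   low if it falsifies at most mu / 2 clauses; satisfying assignments are low. Put L = n ln k / k and
   let S be a maximal set of low assignments with pairwise Hamming distances at least L, so that every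
   low assignment is within L of S. With high probability
   (1) the low assignments are an exponentially small fraction of all assignments,
   (2) no Hamming ball of radius 2L + 1 contains more than k elements of S, and
   (3) if sigma and tau are within 2L of each other, then among the literal occurrences in the clauses
       falsified by sigma at most k mu / 6 have a variable on which sigma and tau differ.
   Each bound is an exponential moment estimate and a union bound. While the walk is at an assignment
   sigma that is not low, (3) makes it step towards a given t in S within 2L with probability at most
   1/3, so the mean of 2^(-d(sigma, t)) does not grow. Hence the sum of these weights over all t in S
   within 2L is a supermartingale up to an error of 2k 2^(-2L) per step, caused by the at most k
   elements t that come into range. The sum is at least 2^(-L) once the walk reaches a low assignment
   and is tiny on average at the start by (1), which bounds the success probability. *)

theory Submission
  imports Defs
begin

section \<open>Distances, hits and the potential\<close>

definition hdist :: "nat \<Rightarrow> assignment \<Rightarrow> assignment \<Rightarrow> nat" where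
  "hdist n \<sigma> \<tau> = card {v. v < n \<and> \<sigma> v \<noteq> \<tau> v}"

text \<open>Counts the choices of a falsified clause and a position in it whose flip moves
  \<open>\<sigma>\<close> towards \<open>\<tau>\<close>. Divided by
  \<open>k * card (unsat_clauses k m \<Phi> \<sigma>)\<close> it is the probability that the next
  step decreases the distance.\<close>

definition hits :: "nat \<Rightarrow> nat \<Rightarrow> cnf \<Rightarrow> assignment \<Rightarrow> assignment \<Rightarrow> nat" where
  "hits k m \<Phi> \<sigma> \<tau> = (\<Sum>i\<in>unsat_clauses k m \<Phi> \<sigma>. card {j. j < k \<and> \<sigma> (fst (\<Phi> i j)) \<noteq> \<tau> (fst (\<Phi> i j))})"

text \<open>Truncation at \<open>\<rho>\<close> keeps only those \<open>t\<close> for which a bound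
  on \<open>hits\<close> will be available. It is used with \<open>\<rho> = 2 * L\<close>.\<close>

definition potential :: "nat \<Rightarrow> assignment set \<Rightarrow> real \<Rightarrow> assignment \<Rightarrow> real" where
  "potential n S \<rho> \<sigma> = (\<Sum>t\<in>{t\<in>S. real (hdist n \<sigma> t) \<le> \<rho>}. (1/2) ^ hdist n \<sigma> t)"

lemma finite_assignments: "finite (assignments n)"
  by (simp add: assignments_def finite_PiE)

lemma card_assignments: "card (assignments n) = 2 ^ n"
  by (simp add: assignments_def card_PiE)

lemma flip_assignments: "\<sigma> \<in> assignments n \<Longrightarrow> v < n \<Longrightarrow> flip \<sigma> v \<in> assignments n"
  unfolding assignments_def flip_def by (auto simp: PiE_def extensional_def)

lemma formulas_var_less:
  "\<Phi> \<in> formulas n k m \<Longrightarrow> i < m \<Longrightarrow> j < k \<Longrightarrow> fst (\<Phi> i j) < n"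
proof -
  assume "\<Phi> \<in> formulas n k m" "i < m" "j < k"
  then have "\<Phi> i j \<in> {..<n} \<times> UNIV"
    unfolding formulas_def by (meson PiE_mem lessThan_iff)
  then show ?thesis by auto
qed

lemma hdist_flip:
  assumes "v < n"
  shows "\<sigma> v \<noteq> \<tau> v \<Longrightarrow> hdist n \<sigma> \<tau> = Suc (hdist n (flip \<sigma> v) \<tau>)"
    and "\<sigma> v = \<tau> v \<Longrightarrow> hdist n (flip \<sigma> v) \<tau> = Suc (hdist n \<sigma> \<tau>)"
proof -
  assume "\<sigma> v \<noteq> \<tau> v"
  then have "{u. u < n \<and> \<sigma> u \<noteq> \<tau> u} = insert v {u. u < n \<and> flip \<sigma> v u \<noteq> \<tau> u}"
    and "v \<notin> {u. u < n \<and> flip \<sigma> v u \<noteq> \<tau> u}"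
    using assms by (auto simp: flip_def)
  then show "hdist n \<sigma> \<tau> = Suc (hdist n (flip \<sigma> v) \<tau>)"
    by (simp add: hdist_def)
next
  assume "\<sigma> v = \<tau> v"
  then have "{u. u < n \<and> flip \<sigma> v u \<noteq> \<tau> u} = insert v {u. u < n \<and> \<sigma> u \<noteq> \<tau> u}"
    and "v \<notin> {u. u < n \<and> \<sigma> u \<noteq> \<tau> u}"
    using assms by (auto simp: flip_def)
  then show "hdist n (flip \<sigma> v) \<tau> = Suc (hdist n \<sigma> \<tau>)"
    by (simp add: hdist_def)
qed

lemma satisfies_iff: "satisfies k m \<Phi> \<sigma> \<longleftrightarrow> unsat_clauses k m \<Phi> \<sigma> = {}"
  by (auto simp: satisfies_def unsat_clauses_def)

lemma walk_succ_le_1: "walk_succ k m \<Phi> \<sigma> r \<le> 1"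
proof (induction r arbitrary: \<sigma>)
  case 0
  then show ?case by simp
next
  case (Suc r)
  let ?U = "unsat_clauses k m \<Phi> \<sigma>"
  have "(\<Sum>i\<in>?U. \<Sum>j<k. walk_succ k m \<Phi> (flip \<sigma> (fst (\<Phi> i j))) r) \<le> (\<Sum>i\<in>?U. \<Sum>j<k. 1)"
    by (intro sum_mono Suc)
  also have "\<dots> = real (card ?U) * real k" by simp
  finally show ?case
    \<comment> \<open>Without the assumption \<open>k > 0\<close> the denominator may vanish; the
      quotient is then 0 by convention.\<close>
    by (cases "real (card ?U) * real k = 0") (auto simp: divide_le_eq_1 zero_less_mult_iff)
qed

section \<open>Drift of the potential and the success of the walk\<close>

lemma potential_nonneg: "potential n S \<rho> \<sigma> \<ge> 0"
  unfolding potential_def by (intro sum_nonneg) auto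

text \<open>A flip changes each distance by exactly one. An element that comes into range was at
  distance in \<open>(\<rho>, \<rho> + 1]\<close>, so there are at most \<open>k\<close> of them,
  each with new weight at most \<open>2 powr (1 - \<rho>)\<close>. Elements that leave the range
  stay in the sum on the right, which only enlarges it.\<close>

lemma potential_flip_le:
  assumes "finite S" "v < n"
    and few: "card {t\<in>S. real (hdist n \<sigma> t) \<le> \<rho> + 1} \<le> k"
  shows "potential n S \<rho> (flip \<sigma> v) \<le>
    (\<Sum>t\<in>{t\<in>S. real (hdist n \<sigma> t) \<le> \<rho>}. (1/2) ^ hdist n (flip \<sigma> v) t) + 2 * k * 2 powr (-\<rho>)"
proof -
  let ?d = "hdist n \<sigma>" and ?d' = "hdist n (flip \<sigma> v)"
  let ?A = "{t\<in>S. real (?d t) \<le> \<rho>}"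
  let ?B = "{t\<in>S. real (?d t) \<le> \<rho> + 1 \<and> \<not> real (?d t) \<le> \<rho>}"
  have step: "real (?d t) \<le> real (?d' t) + 1" for t
    using hdist_flip[OF assms(2), of \<sigma> t] by (cases "\<sigma> v = t v") auto
  have sub: "{t\<in>S. real (?d' t) \<le> \<rho>} \<subseteq> ?A \<union> ?B"
  proof
    fix t assume "t \<in> {t\<in>S. real (?d' t) \<le> \<rho>}"
    then show "t \<in> ?A \<union> ?B" using step[of t] by auto
  qed
  have B: "(1/2::real) ^ ?d' t \<le> 2 * 2 powr (-\<rho>)" if "t \<in> ?B" for t
  proof -
    have "(1/2::real) ^ ?d' t = 2 powr (- real (?d' t))"
      by (simp add: powr_minus powr_realpow power_one_over divide_simps)
    also have "\<dots> \<le> 2 powr (1 - \<rho>)"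
      using that step[of t] by (intro powr_mono) auto
    also have "\<dots> = 2 * 2 powr (-\<rho>)"
      using powr_add[of "2::real" 1 "-\<rho>"] by simp
    finally show ?thesis .
  qed
  have "potential n S \<rho> (flip \<sigma> v) \<le> (\<Sum>t\<in>?A \<union> ?B. (1/2) ^ ?d' t)"
    unfolding potential_def by (rule sum_mono2) (use sub assms(1) in auto)
  also have "\<dots> = (\<Sum>t\<in>?A. (1/2) ^ ?d' t) + (\<Sum>t\<in>?B. (1/2) ^ ?d' t)"
    by (rule sum.union_disjoint) (use assms(1) in auto)
  also have "(\<Sum>t\<in>?B. (1/2::real) ^ ?d' t) \<le> of_nat (card ?B) * (2 * 2 powr (-\<rho>))"
    by (rule sum_bounded_above) (use B in auto)
  also have "\<dots> \<le> k * (2 * 2 powr (-\<rho>))"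
  proof -
    have "card ?B \<le> card {t\<in>S. real (?d t) \<le> \<rho> + 1}"
      by (rule card_mono) (use assms(1) in auto)
    then show ?thesis using few by (intro mult_right_mono) auto
  qed
  finally show ?thesis by (simp add: mult_ac)
qed

lemma sum_affine:
  fixes h a b :: real
  shows "(\<Sum>i\<in>A. h * (a + b * f i)) = h * (card A * a + b * (\<Sum>i\<in>A. f i))"
  by (simp add: sum_distrib_left[symmetric] sum.distrib del: sum_distrib_left)

text \<open>A step that moves towards \<open>t\<close> with probability at most \<open>1/3\<close> does not increase the mean of
  \<open>2 ^ (- hdist n \<sigma> t)\<close>, because \<open>2 * (1/3) + (1/2) * (2/3) = 1\<close>.\<close>

lemma sum_flip_le:
  assumes \<Phi>: "\<Phi> \<in> formulas n k m"
    and hits: "3 * hits k m \<Phi> \<sigma> t \<le> k * card (unsat_clauses k m \<Phi> \<sigma>)"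
  shows "(\<Sum>i\<in>unsat_clauses k m \<Phi> \<sigma>. \<Sum>j<k. (1/2::real) ^ hdist n (flip \<sigma> (fst (\<Phi> i j))) t)
    \<le> (1/2) ^ hdist n \<sigma> t * (real (card (unsat_clauses k m \<Phi> \<sigma>)) * real k)"
proof -
  let ?U = "unsat_clauses k m \<Phi> \<sigma>" and ?h = "(1/2::real) ^ hdist n \<sigma> t"
  \<comment> \<open>The weight doubles if the flip removes a disagreement and halves otherwise.
    Writing the factor as an affine function of the indicator turns the sum over \<open>j\<close>
    into a count of hits.\<close>
  have *: "(1/2::real) ^ hdist n (flip \<sigma> v) t = ?h * (1/2 + (3/2) * of_bool (\<sigma> v \<noteq> t v))" if "v < n" for v
    using hdist_flip[OF that, of \<sigma> t] by (cases "\<sigma> v = t v") auto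
  have "(\<Sum>j<k. (1/2::real) ^ hdist n (flip \<sigma> (fst (\<Phi> i j))) t) =
     ?h * (k / 2 + 3/2 * card {j. j < k \<and> \<sigma> (fst (\<Phi> i j)) \<noteq> t (fst (\<Phi> i j))})" if "i \<in> ?U" for i
  proof -
    have "i < m" using that by (simp add: unsat_clauses_def)
    have "(\<Sum>j<k. (1/2::real) ^ hdist n (flip \<sigma> (fst (\<Phi> i j))) t) =
      (\<Sum>j<k. ?h * (1/2 + (3/2) * of_bool (\<sigma> (fst (\<Phi> i j)) \<noteq> t (fst (\<Phi> i j)))))"
      by (intro sum.cong refl *) (use formulas_var_less[OF \<Phi> \<open>i < m\<close>] in auto)
    also have "\<dots> = ?h * (k / 2 + 3/2 * (\<Sum>j<k. of_bool (\<sigma> (fst (\<Phi> i j)) \<noteq> t (fst (\<Phi> i j)))))"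
      by (subst sum_affine) simp
    also have "(\<Sum>j<k. of_bool (\<sigma> (fst (\<Phi> i j)) \<noteq> t (fst (\<Phi> i j))) :: real) =
       card {j. j < k \<and> \<sigma> (fst (\<Phi> i j)) \<noteq> t (fst (\<Phi> i j))}"
      by (simp add: of_bool_def sum.If_cases Int_def)
    finally show ?thesis .
  qed
  then have "(\<Sum>i\<in>?U. \<Sum>j<k. (1/2::real) ^ hdist n (flip \<sigma> (fst (\<Phi> i j))) t) =
    (\<Sum>i\<in>?U. ?h * (k / 2 + 3/2 * card {j. j < k \<and> \<sigma> (fst (\<Phi> i j)) \<noteq> t (fst (\<Phi> i j))}))"
    by simp
  also have "\<dots> = ?h * (card ?U * k / 2 + 3/2 * hits k m \<Phi> \<sigma> t)"
    by (subst sum_affine) (simp add: hits_def)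
  also have "\<dots> \<le> ?h * (real (card ?U) * k)"
  proof -
    have "3 * real (hits k m \<Phi> \<sigma> t) \<le> real k * real (card ?U)"
      using hits by (metis of_nat_le_iff of_nat_mult of_nat_numeral)
    then show ?thesis by (intro mult_left_mono) (auto simp: field_simps)
  qed
  finally show ?thesis .
qed

text \<open>Induction on the number of remaining steps. At an assignment with at most
  \<open>u\<close> falsified clauses the right-hand side is already at least 1, so the walk need not
  be followed beyond it. Elsewhere one step raises the mean potential by at most the error
  \<open>2 * k * 2 powr (-(2*L))\<close>, which pays for the increment of \<open>r\<close>.\<close>

lemma walk_succ_le_potential:
  fixes L u :: real
  assumes \<Phi>: "\<Phi> \<in> formulas n k m" and "k > 0" "L \<ge> 0" "finite S" "u \<ge> 0"
    and cover: "\<And>\<sigma>. \<sigma> \<in> assignments n \<Longrightarrow> card (unsat_clauses k m \<Phi> \<sigma>) \<le> u \<Longrightarrow>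
       \<exists>t\<in>S. hdist n \<sigma> t \<le> L"
    and hits: "\<And>\<sigma> t. \<sigma> \<in> assignments n \<Longrightarrow> t \<in> S \<Longrightarrow> hdist n \<sigma> t \<le> 2 * L \<Longrightarrow>
       3 * hits k m \<Phi> \<sigma> t \<le> k * u"
    and few: "\<And>\<sigma>. \<sigma> \<in> assignments n \<Longrightarrow> card {t\<in>S. real (hdist n \<sigma> t) \<le> 2 * L + 1} \<le> k"
    and \<sigma>: "\<sigma> \<in> assignments n"
  shows "walk_succ k m \<Phi> \<sigma> r \<le> 2 powr L * (potential n S (2*L) \<sigma> + r * (2 * k * 2 powr (-(2*L))))"
proof -
  have big: "1 \<le> 2 powr L * potential n S (2*L) \<sigma>"
    if \<sigma>: "\<sigma> \<in> assignments n" "card (unsat_clauses k m \<Phi> \<sigma>) \<le> u" for \<sigma>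
  proof -
    obtain t where t: "t \<in> S" "hdist n \<sigma> t \<le> L" using cover[OF \<sigma>] by blast
    have "1 = 2 powr L * 2 powr (-L)" by (simp flip: powr_add)
    also have "2 powr (-L) \<le> 2 powr (- real (hdist n \<sigma> t))"
      using t by (intro powr_mono) auto
    also have "\<dots> = (1/2) ^ hdist n \<sigma> t"
      by (simp add: powr_minus powr_realpow power_one_over divide_simps)
    also have "\<dots> \<le> potential n S (2*L) \<sigma>"
      unfolding potential_def by (rule member_le_sum) (use t \<open>L \<ge> 0\<close> \<open>finite S\<close> in auto)
    finally show ?thesis by simp
  qed
  show ?thesis
    using \<sigma>
  proof (induction r arbitrary: \<sigma>)
    case (0 \<sigma>)
    show ?case
      \<comment> \<open>A satisfying assignment falsifies \<open>0 \<le> u\<close> clauses, so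
        \<open>big\<close> applies to it.\<close>
      using big[OF 0] \<open>u \<ge> 0\<close> potential_nonneg[of n S "2*L" \<sigma>] by (simp add: satisfies_iff)
  next
    case (Suc r \<sigma>)
    let ?U = "unsat_clauses k m \<Phi> \<sigma>" and ?K = "2 * real k * 2 powr (-(2*L))"
    let ?G = "potential n S (2*L)"
    show ?case
    proof (cases "card ?U \<le> u")
      case True
      have "0 \<le> 2 powr L * (Suc r * ?K)" by simp
      with big[OF Suc.prems True] show ?thesis
        using walk_succ_le_1[of k m \<Phi> \<sigma> "Suc r"] by (simp only: distrib_left)
    next
      case False
      define N where "N = real (card ?U) * real k"
      have "N > 0" using False \<open>u \<ge> 0\<close> \<open>k > 0\<close> by (auto simp: N_def)
      let ?A = "{t\<in>S. real (hdist n \<sigma> t) \<le> 2*L}"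
      have var: "fst (\<Phi> i j) < n" if "i \<in> ?U" "j < k" for i j
        using that formulas_var_less[OF \<Phi>] by (simp add: unsat_clauses_def)
      have "(\<Sum>i\<in>?U. \<Sum>j<k. ?G (flip \<sigma> (fst (\<Phi> i j))))
          \<le> (\<Sum>i\<in>?U. \<Sum>j<k. (\<Sum>t\<in>?A. (1/2) ^ hdist n (flip \<sigma> (fst (\<Phi> i j))) t) + ?K)"
        by (rule sum_mono, rule sum_mono, rule potential_flip_le[OF \<open>finite S\<close> var few[OF Suc.prems]]) auto
      also have "\<dots> = (\<Sum>i\<in>?U. \<Sum>j<k. \<Sum>t\<in>?A. (1/2) ^ hdist n (flip \<sigma> (fst (\<Phi> i j))) t) + N * ?K"
        by (simp add: sum.distrib N_def)
      also have "(\<Sum>i\<in>?U. \<Sum>j<k. \<Sum>t\<in>?A. (1/2::real) ^ hdist n (flip \<sigma> (fst (\<Phi> i j))) t) =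
          (\<Sum>t\<in>?A. \<Sum>i\<in>?U. \<Sum>j<k. (1/2) ^ hdist n (flip \<sigma> (fst (\<Phi> i j))) t)"
        by (subst sum.swap[of _ _ "{..<k}"], subst sum.swap) (rule refl)
      also have "\<dots> \<le> (\<Sum>t\<in>?A. (1/2) ^ hdist n \<sigma> t * N)"
      proof (rule sum_mono)
        fix t assume t: "t \<in> ?A"
        \<comment> \<open>The hypothesis compares the hits with \<open>u\<close>. Since more than
          \<open>u\<close> clauses are falsified here, the comparison passes to their actual number,
          as \<open>sum_flip_le\<close> requires.\<close>
        have "real k * u \<le> real k * card ?U" using False by (intro mult_left_mono) auto
        with hits[of \<sigma> t] t Suc.prems have "real (3 * hits k m \<Phi> \<sigma> t) \<le> real (k * card ?U)" by simp
        then have "3 * hits k m \<Phi> \<sigma> t \<le> k * card ?U" by (simp only: of_nat_le_iff)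
        from sum_flip_le[OF \<Phi> this]
        show "(\<Sum>i\<in>?U. \<Sum>j<k. (1/2::real) ^ hdist n (flip \<sigma> (fst (\<Phi> i j))) t) \<le> (1/2) ^ hdist n \<sigma> t * N"
          by (simp add: N_def)
      qed
      also have "\<dots> = N * ?G \<sigma>"
        by (simp add: potential_def sum_distrib_left mult_ac)
      finally have G: "(\<Sum>i\<in>?U. \<Sum>j<k. ?G (flip \<sigma> (fst (\<Phi> i j)))) \<le> N * (?G \<sigma> + ?K)"
        by (simp add: algebra_simps)
      have "(\<Sum>i\<in>?U. \<Sum>j<k. walk_succ k m \<Phi> (flip \<sigma> (fst (\<Phi> i j))) r)
         \<le> (\<Sum>i\<in>?U. \<Sum>j<k. 2 powr L * (?G (flip \<sigma> (fst (\<Phi> i j))) + r * ?K))"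
        by (intro sum_mono Suc.IH flip_assignments Suc.prems) (use var in auto)
      also have "\<dots> = 2 powr L * ((\<Sum>i\<in>?U. \<Sum>j<k. ?G (flip \<sigma> (fst (\<Phi> i j)))) + N * (r * ?K))"
        by (simp add: sum.distrib N_def distrib_left flip: sum_distrib_left)
      also have "\<dots> \<le> 2 powr L * (N * (?G \<sigma> + ?K) + N * (r * ?K))"
        using G by (intro mult_left_mono add_right_mono) auto
      also have "\<dots> = (2 powr L * (?G \<sigma> + Suc r * ?K)) * N" by (simp add: algebra_simps)
      finally have "(\<Sum>i\<in>?U. \<Sum>j<k. walk_succ k m \<Phi> (flip \<sigma> (fst (\<Phi> i j))) r) / N
        \<le> 2 powr L * (?G \<sigma> + Suc r * ?K)"
        using \<open>N > 0\<close> by (subst pos_divide_le_eq) auto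
      moreover have "\<not> satisfies k m \<Phi> \<sigma>" using False \<open>u \<ge> 0\<close> by (auto simp: satisfies_iff)
      ultimately show ?thesis by (simp add: N_def)
    qed
  qed
qed

section \<open>Uniform averages as expectations\<close>

definition avg :: "'a set \<Rightarrow> ('a \<Rightarrow> real) \<Rightarrow> real" where
  "avg A f = (\<Sum>x\<in>A. f x) / card A"

lemma avg_mono: "(\<And>x. x \<in> A \<Longrightarrow> f x \<le> g x) \<Longrightarrow> avg A f \<le> avg A g"
  unfolding avg_def by (intro divide_right_mono sum_mono) auto

lemma avg_nonneg: "(\<And>x. x \<in> A \<Longrightarrow> 0 \<le> f x) \<Longrightarrow> 0 \<le> avg A f"
  unfolding avg_def by (intro divide_nonneg_nonneg sum_nonneg) auto

lemma avg_cong: "(\<And>x. x \<in> A \<Longrightarrow> f x = g x) \<Longrightarrow> avg A f = avg A g"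
  unfolding avg_def by (auto intro: sum.cong)

lemma avg_add: "avg A (\<lambda>x. f x + g x) = avg A f + avg A g"
  by (simp add: avg_def sum.distrib add_divide_distrib)

lemma avg_diff: "avg A (\<lambda>x. f x - g x) = avg A f - avg A g"
  by (simp add: avg_def sum_subtractf diff_divide_distrib)

lemma avg_cmult: "avg A (\<lambda>x. c * f x) = c * avg A f"
  by (simp add: avg_def sum_distrib_left)

lemma avg_const: "finite A \<Longrightarrow> A \<noteq> {} \<Longrightarrow> avg A (\<lambda>x. c) = c"
  by (simp add: avg_def)

lemma avg_sum: "avg A (\<lambda>x. \<Sum>i\<in>I. f i x) = (\<Sum>i\<in>I. avg A (f i))"
  unfolding avg_def by (subst sum.swap) (simp add: sum_divide_distrib)

text \<open>This is independence of the coordinates of a uniform element of a product set. It serves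
  twice: for the literals of a clause and for the clauses of a formula.\<close>

lemma avg_PiE_prod:
  assumes "finite I" "finite A"
  shows "avg (I \<rightarrow>\<^sub>E A) (\<lambda>f. \<Prod>i\<in>I. g (f i)) = avg A g ^ card I"
proof -
  have "(\<Sum>f\<in>I \<rightarrow>\<^sub>E A. \<Prod>i\<in>I. g (f i)) = (\<Prod>i\<in>I. \<Sum>x\<in>A. g x)"
    by (rule prod_sum_PiE[symmetric]) (use assms in auto)
  then show ?thesis
    by (simp add: avg_def card_PiE assms power_divide)
qed

section \<open>Moments of a single random clause\<close>

definition literals :: "nat \<Rightarrow> lit set" where
  "literals n = {..<n} \<times> UNIV"

definition clauses :: "nat \<Rightarrow> nat \<Rightarrow> (nat \<Rightarrow> lit) set" where
  "clauses n k = {..<k} \<rightarrow>\<^sub>E literals n"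

text \<open>Takes a clause rather than an index into a formula, so that it can be averaged over
  \<open>clauses n k\<close>.\<close>

definition falsified :: "nat \<Rightarrow> (nat \<Rightarrow> lit) \<Rightarrow> assignment \<Rightarrow> bool" where
  "falsified k c \<sigma> \<longleftrightarrow> (\<forall>j<k. \<not> lit_sat \<sigma> (c j))"

lemma finite_literals: "finite (literals n)"
  by (simp add: literals_def)

lemma finite_clauses: "finite (clauses n k)"
  by (simp add: clauses_def finite_PiE finite_literals)

lemma clauses_nonempty: "n > 0 \<Longrightarrow> clauses n k \<noteq> {}"
  by (auto simp: clauses_def literals_def PiE_eq_empty_iff)

lemma formulas_eq: "formulas n k m = {..<m} \<rightarrow>\<^sub>E clauses n k"
  by (simp add: formulas_def clauses_def literals_def)

lemma finite_formulas: "finite (formulas n k m)"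
  by (simp add: formulas_eq finite_PiE finite_clauses)

lemma formulas_nonempty: "n > 0 \<Longrightarrow> formulas n k m \<noteq> {}"
  by (simp add: formulas_eq PiE_eq_empty_iff clauses_nonempty)

lemma unsat_clauses_falsified: "unsat_clauses k m \<Phi> \<sigma> = {i. i < m \<and> falsified k (\<Phi> i) \<sigma>}"
  by (auto simp: unsat_clauses_def falsified_def clause_sat_def)

lemma avg_formulas_prod:
  "avg (formulas n k m) (\<lambda>\<Phi>. \<Prod>i<m. g (\<Phi> i)) = avg (clauses n k) g ^ m"
  unfolding formulas_eq using avg_PiE_prod[of "{..<m}" "clauses n k" g] by (simp add: finite_clauses)

text \<open>Of the two literals of each variable exactly one is false under \<open>\<sigma>\<close>,
  and the \<open>k\<close> literals are independent. Different \<open>h\<close> give all the clause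
  moments below: the constant 1 for one assignment, the indicator of agreement for two, and a weight
  5/4 on disagreements for hits.\<close>

lemma avg_clauses_falsified_prod:
  "avg (clauses n k) (\<lambda>c. of_bool (falsified k c \<sigma>) * (\<Prod>j<k. h (fst (c j))))
     = ((\<Sum>v<n. h v) / (2 * n)) ^ k"
proof -
  let ?g = "\<lambda>l. if lit_sat \<sigma> l then 0 else h (fst l)"
  have "(\<Sum>l\<in>literals n. ?g l) = (\<Sum>v<n. \<Sum>s\<in>UNIV. if lit_sat \<sigma> (v, s) then 0 else h v)"
    unfolding literals_def by (simp add: sum.cartesian_product case_prod_unfold)
  also have "\<dots> = (\<Sum>v<n. h v)"
    by (intro sum.cong refl) (simp add: UNIV_bool lit_sat_def)
  finally have "avg (literals n) ?g = (\<Sum>v<n. h v) / (2 * n)"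
    by (simp add: avg_def literals_def mult.commute)
  \<comment> \<open>The indicator of falsification is absorbed into the product: any true literal
    contributes a factor 0.\<close>
  moreover have "of_bool (falsified k c \<sigma>) * (\<Prod>j<k. h (fst (c j))) = (\<Prod>j<k. ?g (c j))" for c
    by (auto simp: falsified_def)
  ultimately show ?thesis
    unfolding clauses_def using avg_PiE_prod[of "{..<k}" "literals n" ?g]
    by (simp add: finite_literals)
qed

lemma avg_falsified: "n > 0 \<Longrightarrow> avg (clauses n k) (\<lambda>c. of_bool (falsified k c \<sigma>)) = (1/2) ^ k"
  using avg_clauses_falsified_prod[of n k \<sigma> "\<lambda>_. 1"] by (simp add: power_divide)

lemma hdist_le: "hdist n \<sigma> \<tau> \<le> n"
proof -
  have "hdist n \<sigma> \<tau> \<le> card {..<n}" unfolding hdist_def by (rule card_mono) auto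
  then show ?thesis by simp
qed

lemma hdist_eq_sum: "real (hdist n \<sigma> \<tau>) = (\<Sum>v<n. of_bool (\<sigma> v \<noteq> \<tau> v))"
  by (simp add: hdist_def of_bool_def sum.If_cases Int_def)

text \<open>A clause falsified by \<open>\<sigma>\<close> is falsified by \<open>\<tau>\<close> too
  exactly when the two agree on all its variables.\<close>

lemma avg_falsified_both:
  "avg (clauses n k) (\<lambda>c. of_bool (falsified k c \<sigma>) * of_bool (falsified k c \<tau>))
     = ((n - real (hdist n \<sigma> \<tau>)) / (2 * n)) ^ k"
proof -
  have "of_bool (falsified k c \<sigma>) * of_bool (falsified k c \<tau>) =
     of_bool (falsified k c \<sigma>) * (\<Prod>j<k. 1 - of_bool (\<sigma> (fst (c j)) \<noteq> \<tau> (fst (c j))) :: real)" for c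
  proof (cases "\<forall>j<k. \<sigma> (fst (c j)) = \<tau> (fst (c j))")
    case True
    then show ?thesis by (auto simp: falsified_def lit_sat_def)
  next
    case False
    then have "(\<Prod>j<k. 1 - of_bool (\<sigma> (fst (c j)) \<noteq> \<tau> (fst (c j))) :: real) = 0" by auto
    with False show ?thesis by (auto simp: falsified_def lit_sat_def)
  qed
  then have "avg (clauses n k) (\<lambda>c. of_bool (falsified k c \<sigma>) * of_bool (falsified k c \<tau>)) =
      ((\<Sum>v<n. 1 - of_bool (\<sigma> v \<noteq> \<tau> v)) / (2 * n)) ^ k"
    using avg_clauses_falsified_prod[of n k \<sigma> "\<lambda>v. 1 - of_bool (\<sigma> v \<noteq> \<tau> v)"]
    by (simp only:)
  then show ?thesis
    by (simp only: sum_subtractf hdist_eq_sum) simp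
qed

text \<open>This fixes the scale \<open>n * ln k / k\<close>: at that distance
  \<open>(1 - d/n)^k \<le> exp (- k * d / n) \<le> 1/k\<close>, so falsifying both is
  \<open>k\<close> times rarer than falsifying one.\<close>

lemma avg_falsified_both_le:
  assumes "n > 0" "k > 0" and far: "n * ln k / k \<le> hdist n \<sigma> \<tau>"
  shows "avg (clauses n k) (\<lambda>c. of_bool (falsified k c \<sigma>) * of_bool (falsified k c \<tau>)) \<le> (1/2) ^ k / k"
proof -
  let ?d = "real (hdist n \<sigma> \<tau>)"
  have le: "?d \<le> n" using hdist_le by simp
  have "((n - ?d) / (2 * n)) ^ k = (1/2) ^ k * (1 - ?d / n) ^ k"
  proof -
    have "(n - ?d) / (2 * n) = 1/2 * (1 - ?d / n)" using assms by (simp add: field_simps)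
    then show ?thesis by (simp only: power_mult_distrib)
  qed
  also have "\<dots> \<le> (1/2) ^ k * exp (- ?d / n) ^ k"
    using exp_ge_add_one_self[of "- ?d / n"] le assms
    by (intro mult_left_mono power_mono) (auto simp: field_simps)
  also have "exp (- ?d / n) ^ k = exp (- (k * ?d / n))"
    by (simp flip: exp_of_nat_mult)
  also have "\<dots> \<le> exp (- ln k)"
    using far assms by (simp add: field_simps)
  also have "exp (- ln k) = 1 / k"
    using assms by (simp add: exp_minus field_simps)
  finally show ?thesis by (simp add: avg_falsified_both)
qed

text \<open>The expansion of \<open>(1 - 1/2) ^ N\<close> cut after the quadratic term, as in a
  Bonferroni inequality. Only first and pair moments of the falsification indicators are then
  needed.\<close>

lemma half_power_le: "(1/2::real) ^ N \<le> 1 - N / 2 + real N * (real N - 1) / 8"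
proof (induction N)
  case (Suc N)
  define p where "p = (1/2::real) ^ N"
  have "p \<ge> 1 - N / 2"
    using Bernoulli_inequality[of "-1/2::real" N] by (simp add: p_def)
  moreover have "p \<le> 1 - N / 2 + (real N * real N - real N) / 8"
    using Suc by (simp add: p_def right_diff_distrib)
  \<comment> \<open>Write \<open>p / 2\<close> as \<open>p - p / 2\<close> and use the upper bound
    for the first \<open>p\<close>, the lower bound for the second.\<close>
  ultimately have "p / 2 \<le> 1 - (N + 1) / 2 + (real N * real N + real N) / 8"
    by (simp add: field_simps)
  then show ?case by (simp add: p_def algebra_simps)
qed simp

section \<open>Moment bounds over random formulas, and ball volume\<close>

lemma formula_prob_avg: "formula_prob n k m P = avg (formulas n k m) (\<lambda>\<Phi>. of_bool (P \<Phi>))"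
  by (simp add: formula_prob_def avg_def finite_formulas of_bool_def sum.If_cases Int_def)

lemma formula_prob_markov:
  assumes "\<And>\<Phi>. \<Phi> \<in> formulas n k m \<Longrightarrow> 0 \<le> f \<Phi>"
    and "\<And>\<Phi>. \<Phi> \<in> formulas n k m \<Longrightarrow> P \<Phi> \<Longrightarrow> 1 \<le> f \<Phi>"
  shows "formula_prob n k m P \<le> avg (formulas n k m) f"
  unfolding formula_prob_avg by (rule avg_mono) (use assms in \<open>auto simp: of_bool_def\<close>)

lemma formula_prob_union:
  assumes "finite X"
  shows "formula_prob n k m (\<lambda>\<Phi>. \<exists>x\<in>X. P x \<Phi>) \<le> (\<Sum>x\<in>X. formula_prob n k m (P x))"
proof -
  have "formula_prob n k m (\<lambda>\<Phi>. \<exists>x\<in>X. P x \<Phi>) \<le> avg (formulas n k m) (\<lambda>\<Phi>. \<Sum>x\<in>X. of_bool (P x \<Phi>))"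
  proof (rule formula_prob_markov)
    fix \<Phi> assume "\<exists>x\<in>X. P x \<Phi>"
    then obtain x where "x \<in> X" "P x \<Phi>" by blast
    then show "1 \<le> (\<Sum>x\<in>X. of_bool (P x \<Phi>) :: real)"
      using member_le_sum[of x X "\<lambda>x. of_bool (P x \<Phi>) :: real"] assms by auto
  qed (auto intro: sum_nonneg)
  then show ?thesis by (simp add: avg_sum formula_prob_avg)
qed

text \<open>With \<open>r = card T\<close> and \<open>q = (1/2) ^ k\<close>, the linear term of
  \<open>half_power_le\<close> gives \<open>- r * q / 2\<close>. The pair term is at most
  \<open>r * q / 8\<close>, because there are at most \<open>r * k\<close> ordered pairs and each
  has probability at most \<open>q / k\<close>. This leaves 3/8.\<close>

lemma avg_half_power_falsified_le:
  assumes "n > 0" "k > 0" "finite T" "card T \<le> k"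
    and sep: "\<And>s t. s \<in> T \<Longrightarrow> t \<in> T \<Longrightarrow> s \<noteq> t \<Longrightarrow> n * ln k / k \<le> hdist n s t"
  shows "avg (clauses n k) (\<lambda>c. (1/2) ^ card {t\<in>T. falsified k c t}) \<le> 1 - 3/8 * card T * (1/2) ^ k"
proof -
  define q where "q = (1/2::real) ^ k"
  define r where "r = real (card T)"
  let ?F = "\<lambda>t c. of_bool (falsified k c t) :: real"
  let ?P = "Sigma T (\<lambda>s. T - {s})"
  have N: "real (card {t\<in>T. falsified k c t}) = (\<Sum>t\<in>T. ?F t c)" for c
    using \<open>finite T\<close> by (simp add: of_bool_def sum.If_cases Int_def)
  \<comment> \<open>The indicators are idempotent, so removing the diagonal from the square of their
    sum \<open>N\<close> leaves \<open>N * (N - 1)\<close>.\<close>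
  have N2: "(\<Sum>t\<in>T. ?F t c) * ((\<Sum>t\<in>T. ?F t c) - 1) = (\<Sum>(s,t)\<in>?P. ?F s c * ?F t c)" for c
  proof -
    have "(\<Sum>(s,t)\<in>?P. ?F s c * ?F t c) = (\<Sum>s\<in>T. \<Sum>t\<in>T - {s}. ?F s c * ?F t c)"
      using \<open>finite T\<close> by (subst sum.Sigma) auto
    also have "\<dots> = (\<Sum>s\<in>T. ?F s c * (\<Sum>t\<in>T. ?F t c) - ?F s c)"
    proof (rule sum.cong[OF refl])
      fix s assume "s \<in> T"
      with \<open>finite T\<close> have "(\<Sum>t\<in>T - {s}. ?F t c) = (\<Sum>t\<in>T. ?F t c) - ?F s c"
        by (subst sum_diff1) (simp_all del: sum_of_bool_eq)
      then show "(\<Sum>t\<in>T - {s}. ?F s c * ?F t c) = ?F s c * (\<Sum>t\<in>T. ?F t c) - ?F s c"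
        by (simp only: sum_distrib_left[symmetric]) (simp add: right_diff_distrib del: sum_of_bool_eq)
    qed
    also have "\<dots> = (\<Sum>t\<in>T. ?F t c) * ((\<Sum>t\<in>T. ?F t c) - 1)"
      by (simp add: sum_subtractf right_diff_distrib flip: sum_distrib_right)
    finally show ?thesis ..
  qed
  have "avg (clauses n k) (\<lambda>c. (1/2) ^ card {t\<in>T. falsified k c t})
     \<le> avg (clauses n k) (\<lambda>c. 1 - 1/2 * (\<Sum>t\<in>T. ?F t c) + 1/8 * (\<Sum>p\<in>?P. ?F (fst p) c * ?F (snd p) c))"
  proof (rule avg_mono)
    fix c
    show "(1/2) ^ card {t\<in>T. falsified k c t} \<le>
      1 - 1/2 * (\<Sum>t\<in>T. ?F t c) + 1/8 * (\<Sum>p\<in>?P. ?F (fst p) c * ?F (snd p) c)"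
      using half_power_le[of "card {t\<in>T. falsified k c t}"] N2[of c]
      by (simp add: N case_prod_unfold)
  qed
  also have "\<dots> = 1 - 1/2 * (r * q) + 1/8 * (\<Sum>p\<in>?P. avg (clauses n k) (\<lambda>c. ?F (fst p) c * ?F (snd p) c))"
    unfolding avg_add avg_diff avg_cmult avg_sum
    using \<open>n > 0\<close> by (simp add: avg_const finite_clauses clauses_nonempty avg_falsified q_def r_def)
  also have "(\<Sum>p\<in>?P. avg (clauses n k) (\<lambda>c. ?F (fst p) c * ?F (snd p) c)) \<le> of_nat (card ?P) * (q / k)"
    unfolding q_def
    by (intro sum_bounded_above avg_falsified_both_le \<open>n > 0\<close> \<open>k > 0\<close> sep) auto
  also have "card ?P = card T * (card T - 1)"
    using \<open>finite T\<close> by (simp add: card_SigmaI)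
  also have "real (card T * (card T - 1)) * (q / k) \<le> (r * k) * (q / k)"
    using \<open>card T \<le> k\<close> unfolding r_def of_nat_mult
    by (intro mult_right_mono mult_left_mono) (auto simp: q_def)
  also have "(r * k) * (q / k) = r * q" using \<open>k > 0\<close> by simp
  finally show ?thesis by (simp add: q_def r_def)
qed

text \<open>Distinct elements of \<open>T\<close> are so far apart that their sets of falsified clauses are almost
  disjoint, so the exponent scales with \<open>card T\<close> as it would for independent assignments.\<close>

lemma prob_separated_few_unsat:
  assumes "n > 0" "k > 0" "finite T" "card T \<le> k"
    and sep: "\<And>s t. s \<in> T \<Longrightarrow> t \<in> T \<Longrightarrow> s \<noteq> t \<Longrightarrow> n * ln k / k \<le> hdist n s t"
  shows "formula_prob n k m (\<lambda>\<Phi>. \<forall>t\<in>T. card (unsat_clauses k m \<Phi> t) \<le> m / 2 ^ k / 2)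
     \<le> exp (- (card T * (m / 2 ^ k) / 40))"
proof -
  define \<mu> where "\<mu> = m / 2 ^ k"
  define r where "r = real (card T)"
  let ?N = "\<lambda>c. card {t\<in>T. falsified k c t}"
  let ?Z = "\<lambda>\<Phi>. \<Prod>i<m. (1/2::real) ^ ?N (\<Phi> i)"
  \<comment> \<open>Double counting of the pairs of a clause and an element of \<open>T\<close>
    falsifying it: by clauses the mean factorizes, by elements of \<open>T\<close> the event bounds
    the exponent.\<close>
  have Z: "?Z \<Phi> = (1/2) ^ (\<Sum>t\<in>T. card (unsat_clauses k m \<Phi> t))" for \<Phi>
  proof -
    have "(\<Sum>i<m. ?N (\<Phi> i)) = (\<Sum>i<m. \<Sum>t\<in>T. of_bool (falsified k (\<Phi> i) t))"
      using \<open>finite T\<close> by (simp add: of_bool_def sum.If_cases Int_def)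
    also have "\<dots> = (\<Sum>t\<in>T. card (unsat_clauses k m \<Phi> t))"
      by (subst sum.swap) (simp add: unsat_clauses_falsified of_bool_def sum.If_cases Int_def)
    finally show ?thesis by (simp add: power_sum[symmetric])
  qed
  have "formula_prob n k m (\<lambda>\<Phi>. \<forall>t\<in>T. card (unsat_clauses k m \<Phi> t) \<le> \<mu> / 2)
     \<le> avg (formulas n k m) (\<lambda>\<Phi>. 2 powr (r * \<mu> / 2) * ?Z \<Phi>)"
  proof (rule formula_prob_markov)
    fix \<Phi> assume *: "\<forall>t\<in>T. card (unsat_clauses k m \<Phi> t) \<le> \<mu> / 2"
    have "real (\<Sum>t\<in>T. card (unsat_clauses k m \<Phi> t)) \<le> r * \<mu> / 2"
      using sum_bounded_above[of T "\<lambda>t. real (card (unsat_clauses k m \<Phi> t))" "\<mu>/2"] * by (simp add: r_def)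
    then have "2 powr (- (r * \<mu> / 2)) \<le> 2 powr (- real (\<Sum>t\<in>T. card (unsat_clauses k m \<Phi> t)))"
      by (intro powr_mono) auto
    also have "\<dots> = ?Z \<Phi>"
      unfolding Z by (simp add: powr_minus powr_realpow power_one_over divide_simps del: of_nat_sum)
    finally show "1 \<le> 2 powr (r * \<mu> / 2) * ?Z \<Phi>"
      by (simp add: powr_minus field_simps)
  qed (auto intro!: mult_nonneg_nonneg prod_nonneg)
  also have "\<dots> = 2 powr (r * \<mu> / 2) * avg (clauses n k) (\<lambda>c. (1/2) ^ ?N c) ^ m"
    by (simp only: avg_cmult avg_formulas_prod[of n k m "\<lambda>c. (1/2) ^ ?N c"])
  also have "\<dots> \<le> 2 powr (r * \<mu> / 2) * exp (- (3/8 * r * (1/2) ^ k)) ^ m"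
  proof (intro mult_left_mono power_mono)
    show "avg (clauses n k) (\<lambda>c. (1/2) ^ ?N c) \<le> exp (- (3/8 * r * (1/2) ^ k))"
      using avg_half_power_falsified_le[OF assms] exp_ge_add_one_self[of "- (3/8 * r * (1/2) ^ k)"]
      by (simp add: r_def)
    show "0 \<le> avg (clauses n k) (\<lambda>c. (1/2) ^ ?N c)"
      by (rule avg_nonneg) simp
  qed simp
  also have "exp (- (3/8 * r * (1/2) ^ k)) ^ m = exp (- (3/8 * r * \<mu>))"
    by (simp add: \<mu>_def power_one_over flip: exp_of_nat_mult)
  also have "2 powr (r * \<mu> / 2) * \<dots> = exp (r * \<mu> * (ln 2 / 2 - 3/8))"
    by (simp add: powr_def algebra_simps flip: exp_add)
  \<comment> \<open>Here \<open>3/8 - ln 2 / 2 \<ge> 27/72 - 25/72 = 1/36\<close>, which exceeds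
    1/40.\<close>
  also have "\<dots> \<le> exp (r * \<mu> * (- 1 / 40))"
    using ln2_le_25_over_36 by (subst exp_le_cancel_iff, intro mult_left_mono) (auto simp: r_def \<mu>_def)
  finally show ?thesis by (simp add: r_def \<mu>_def)
qed

text \<open>Give every hit the weight 5/4. At distance at most \<open>2 * n * ln k / k\<close> a
  falsified clause has mean weight at most \<open>exp (ln k / 2) = sqrt k\<close>, whence the term
  \<open>\<mu> * sqrt k\<close> with \<open>\<mu> = m / 2 ^ k\<close>. As
  \<open>exp (1/5) \<le> 5/4\<close>, more than \<open>k * \<mu> / 6\<close> hits have total weight
  at least \<open>exp (k * \<mu> / 30)\<close>.\<close>

lemma prob_many_hits:
  assumes "n > 0" "k > 0" and close: "hdist n \<sigma> \<tau> \<le> 2 * (n * ln k / k)"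
  shows "formula_prob n k m (\<lambda>\<Phi>. \<not> 3 * hits k m \<Phi> \<sigma> \<tau> \<le> k * (m / 2 ^ k / 2))
     \<le> exp (m / 2 ^ k * sqrt k - k * (m / 2 ^ k) / 30)"
proof -
  define \<mu> where "\<mu> = m / 2 ^ k"
  define q where "q = (1/2::real) ^ k"
  define d where "d = real (hdist n \<sigma> \<tau>)"
  let ?h = "\<lambda>v. if \<sigma> v \<noteq> \<tau> v then 5/4 else 1 :: real"
  let ?g = "\<lambda>c. if falsified k c \<sigma> then \<Prod>j<k. ?h (fst (c j)) else 1"
  have clause: "(\<Prod>j<k. ?h (fst (c j))) = (5/4) ^ card {j. j < k \<and> \<sigma> (fst (c j)) \<noteq> \<tau> (fst (c j))}" for c :: "nat \<Rightarrow> lit"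
    by (subst prod.If_cases) (auto simp: Int_def)
  have Z: "(\<Prod>i<m. ?g (\<Phi> i)) = (5/4) ^ hits k m \<Phi> \<sigma> \<tau>" for \<Phi>
  proof -
    have "(\<Prod>i<m. ?g (\<Phi> i)) = (\<Prod>i\<in>unsat_clauses k m \<Phi> \<sigma>. \<Prod>j<k. ?h (fst (\<Phi> i j)))"
      by (subst prod.If_cases) (auto simp: Int_def unsat_clauses_falsified)
    also have "\<dots> = (5/4) ^ hits k m \<Phi> \<sigma> \<tau>"
      unfolding clause hits_def by (simp add: power_sum)
    finally show ?thesis .
  qed
  have e: "exp (1/5) \<le> (5/4::real)"
    using exp_ge_add_one_self[of "-1/5::real"] by (simp add: exp_minus field_simps)
  have "formula_prob n k m (\<lambda>\<Phi>. \<not> 3 * hits k m \<Phi> \<sigma> \<tau> \<le> k * (\<mu> / 2))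
     \<le> avg (formulas n k m) (\<lambda>\<Phi>. exp (- (k * \<mu> / 30)) * (\<Prod>i<m. ?g (\<Phi> i)))"
  proof (rule formula_prob_markov)
    fix \<Phi> assume *: "\<not> 3 * hits k m \<Phi> \<sigma> \<tau> \<le> k * (\<mu> / 2)"
    have "exp (k * \<mu> / 30) \<le> exp (real (hits k m \<Phi> \<sigma> \<tau>) * (1/5))"
      using * by (simp add: not_le mult.commute)
    also have "\<dots> = exp (1/5) ^ hits k m \<Phi> \<sigma> \<tau>"
      by (rule exp_of_nat_mult)
    also have "\<dots> \<le> (5/4) ^ hits k m \<Phi> \<sigma> \<tau>"
      using e by (intro power_mono) auto
    finally show "1 \<le> exp (- (k * \<mu> / 30)) * (\<Prod>i<m. ?g (\<Phi> i))"
      unfolding Z by (simp add: exp_minus field_simps)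
  qed (unfold Z, simp)
  also have "\<dots> = exp (- (k * \<mu> / 30)) * avg (clauses n k) ?g ^ m"
    by (simp only: avg_cmult avg_formulas_prod[of n k m ?g])
  also have "\<dots> \<le> exp (- (k * \<mu> / 30)) * exp (q * sqrt k) ^ m"
  proof (intro mult_left_mono power_mono)
    have "avg (clauses n k) ?g = avg (clauses n k) (\<lambda>c. 1 - of_bool (falsified k c \<sigma>)
        + of_bool (falsified k c \<sigma>) * (\<Prod>j<k. ?h (fst (c j))))"
      by (rule avg_cong) simp
    also have "\<dots> = 1 - q + ((\<Sum>v<n. ?h v) / (2 * n)) ^ k"
      unfolding avg_add avg_diff
      using \<open>n > 0\<close> avg_clauses_falsified_prod[of n k \<sigma> ?h]
      by (simp add: avg_const finite_clauses clauses_nonempty avg_falsified q_def)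
    also have "(\<Sum>v<n. ?h v) = (\<Sum>v<n. 1 + 1/4 * of_bool (\<sigma> v \<noteq> \<tau> v))"
      by (intro sum.cong) auto
    also have "\<dots> = n + d / 4"
      unfolding d_def hdist_eq_sum by (simp only: sum.distrib sum_distrib_left[symmetric]) simp
    also have "(n + d / 4) / (2 * n) = 1/2 * (1 + d / (4 * n))"
      using \<open>n > 0\<close> by (simp add: field_simps)
    also have "(1/2 * (1 + d / (4 * n))) ^ k \<le> (1/2 * exp (d / (4 * n))) ^ k"
      by (intro power_mono mult_left_mono exp_ge_add_one_self) (auto simp: d_def)
    also have "\<dots> = q * exp (k * (d / (4 * n)))"
      by (simp only: power_mult_distrib q_def exp_of_nat_mult)
    also have "\<dots> \<le> q * exp (ln k / 2)"
      using close assms by (intro mult_left_mono) (auto simp: d_def q_def field_simps)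
    also have "exp (ln k / 2) = sqrt k"
      using \<open>k > 0\<close> by (simp add: ln_sqrt[symmetric])
    also have "1 - q + q * sqrt k \<le> 1 + q * sqrt k"
      by (simp add: q_def)
    also have "\<dots> \<le> exp (q * sqrt k)" by (rule exp_ge_add_one_self)
    finally show "avg (clauses n k) ?g \<le> exp (q * sqrt k)" by simp
    show "0 \<le> avg (clauses n k) ?g"
      by (rule avg_nonneg) (auto intro!: prod_nonneg)
  qed simp
  also have "exp (q * sqrt k) ^ m = exp (\<mu> * sqrt k)"
    by (simp add: \<mu>_def q_def power_one_over mult_ac flip: exp_of_nat_mult)
  also have "exp (- (k * \<mu> / 30)) * exp (\<mu> * sqrt k) = exp (\<mu> * sqrt k - k * \<mu> / 30)"
    by (simp flip: exp_add)
  finally show ?thesis by (simp add: \<mu>_def)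
qed

text \<open>Weight each \<open>\<tau>\<close> by \<open>(1/k) ^ hdist n \<sigma> \<tau>\<close>.
  Inside the ball the weight is at least \<open>exp (- \<rho> * ln k)\<close>, and the total over
  all assignments factorizes into \<open>(1 + 1/k) ^ n\<close>.\<close>

lemma card_ball_le:
  fixes k :: nat and \<rho> :: real
  assumes "k > 0"
  shows "card {\<tau>\<in>assignments n. hdist n \<sigma> \<tau> \<le> \<rho>} \<le> exp (n / k + \<rho> * ln k)"
proof -
  let ?w = "\<lambda>v s. if \<sigma> v \<noteq> s then 1 / real k else 1"
  let ?B = "{\<tau>\<in>assignments n. hdist n \<sigma> \<tau> \<le> \<rho>}"
  have w: "(\<Prod>v<n. ?w v (\<tau> v)) = (1 / k) ^ hdist n \<sigma> \<tau>" for \<tau>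
    unfolding hdist_def by (subst prod.If_cases) (auto simp: Int_def)
  have "card ?B * exp (- (\<rho> * ln k)) = (\<Sum>\<tau>\<in>?B. exp (- (\<rho> * ln k)))"
    by simp
  also have "\<dots> \<le> (\<Sum>\<tau>\<in>?B. (1 / k) ^ hdist n \<sigma> \<tau>)"
  proof (rule sum_mono)
    fix \<tau> assume "\<tau> \<in> ?B"
    then have "exp (- (\<rho> * ln k)) \<le> exp (hdist n \<sigma> \<tau> * (- ln k))"
      using assms by (simp add: mult_right_mono)
    also have "\<dots> = exp (- ln k) ^ hdist n \<sigma> \<tau>"
      by (rule exp_of_nat_mult)
    also have "exp (- ln k) = 1 / k"
      using assms by (simp add: exp_minus field_simps)
    finally show "exp (- (\<rho> * ln k)) \<le> (1 / k) ^ hdist n \<sigma> \<tau>" .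
  qed
  also have "\<dots> \<le> (\<Sum>\<tau>\<in>assignments n. (1 / k) ^ hdist n \<sigma> \<tau>)"
    by (rule sum_mono2) (auto simp: finite_assignments)
  also have "\<dots> = (\<Prod>v<n. \<Sum>s\<in>UNIV. ?w v s)"
    unfolding assignments_def w[symmetric] by (rule prod_sum_PiE[symmetric]) auto
  also have "\<dots> = (\<Prod>v<n. 1 + 1 / k)"
    by (intro prod.cong refl) (simp add: UNIV_bool)
  also have "\<dots> = (1 + 1 / k) ^ n" by simp
  also have "\<dots> \<le> exp (1 / k) ^ n"
    by (intro power_mono exp_ge_add_one_self) auto
  also have "\<dots> = exp (n / k)"
    by (simp flip: exp_of_nat_mult)
  finally show ?thesis
    by (simp add: exp_add exp_minus field_simps)
qed

section \<open>Low assignments and the three exceptional events\<close>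

lemma hdist_commute: "hdist n \<sigma> \<tau> = hdist n \<tau> \<sigma>"
  by (simp add: hdist_def eq_commute)

definition low :: "nat \<Rightarrow> nat \<Rightarrow> nat \<Rightarrow> cnf \<Rightarrow> assignment set" where
  "low n k m \<Phi> = {\<sigma>\<in>assignments n. card (unsat_clauses k m \<Phi> \<sigma>) \<le> m / 2 ^ k / 2}"

definition separated :: "nat \<Rightarrow> real \<Rightarrow> assignment set \<Rightarrow> bool" where
  "separated n L T \<longleftrightarrow> (\<forall>s\<in>T. \<forall>t\<in>T. s \<noteq> t \<longrightarrow> L \<le> real (hdist n s t))"

definition ball_n :: "nat \<Rightarrow> assignment \<Rightarrow> real \<Rightarrow> assignment set" where
  "ball_n n \<sigma> \<rho> = {\<tau>\<in>assignments n. real (hdist n \<sigma> \<tau>) \<le> \<rho>}"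

lemma finite_ball_n: "finite (ball_n n \<sigma> \<rho>)"
  by (simp add: ball_n_def finite_assignments)

lemma finite_low: "finite (low n k m \<Phi>)"
  by (simp add: low_def finite_assignments)

lemma card_ball_n_le:
  fixes k :: nat
  shows "k > 0 \<Longrightarrow> card (ball_n n \<sigma> \<rho>) \<le> exp (n / k + \<rho> * ln k)"
  unfolding ball_n_def by (rule card_ball_le)

lemma prob_not_le_sum3:
  assumes "n > 0"
    and "\<And>\<Phi>. \<Phi> \<in> formulas n k m \<Longrightarrow> \<not> A \<Phi> \<Longrightarrow> \<not> B \<Phi> \<Longrightarrow> \<not> C \<Phi> \<Longrightarrow> P \<Phi>"
  shows "1 - (formula_prob n k m A + formula_prob n k m B + formula_prob n k m C) \<le> formula_prob n k m P"
proof -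
  have "avg (formulas n k m) (\<lambda>\<Phi>. 1 - (of_bool (A \<Phi>) + of_bool (B \<Phi>) + of_bool (C \<Phi>)))
      \<le> formula_prob n k m P"
    unfolding formula_prob_avg by (rule avg_mono) (use assms(2) in \<open>auto simp: of_bool_def\<close>)
  then show ?thesis
    unfolding avg_diff avg_add
    by (simp add: formula_prob_avg avg_const finite_formulas formulas_nonempty \<open>n > 0\<close>)
qed

lemma formula_prob_le_1: "formula_prob n k m P \<le> 1"
  unfolding formula_prob_def by (intro divide_le_eq_1[THEN iffD2]) (auto intro: card_mono finite_formulas)

text \<open>\<open>prob_separated_few_unsat\<close> for a singleton bounds the expected proportion
  of low assignments by \<open>exp (- \<mu> / 40)\<close>. Markov's inequality splits this exponent
  evenly between the threshold and the probability.\<close>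

lemma prob_many_low:
  assumes "n > 0" "k > 0"
  shows "formula_prob n k m (\<lambda>\<Phi>. \<not> card (low n k m \<Phi>) \<le> 2 ^ n * exp (- (m / 2 ^ k / 80)))
     \<le> exp (- (m / 2 ^ k / 80))"
proof -
  define \<mu> where "\<mu> = m / 2 ^ k"
  let ?F = "\<lambda>\<sigma> \<Phi>. of_bool (card (unsat_clauses k m \<Phi> \<sigma>) \<le> \<mu> / 2) :: real"
  have low: "real (card (low n k m \<Phi>)) = (\<Sum>\<sigma>\<in>assignments n. ?F \<sigma> \<Phi>)" for \<Phi>
    by (simp add: low_def \<mu>_def of_bool_def sum.If_cases finite_assignments Int_def)
  have "formula_prob n k m (\<lambda>\<Phi>. \<not> card (low n k m \<Phi>) \<le> 2 ^ n * exp (- (\<mu> / 80)))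
     \<le> avg (formulas n k m) (\<lambda>\<Phi>. exp (\<mu> / 80) / 2 ^ n * (\<Sum>\<sigma>\<in>assignments n. ?F \<sigma> \<Phi>))"
    unfolding low[symmetric] by (rule formula_prob_markov) (auto simp: exp_minus field_simps)
  also have "\<dots> = exp (\<mu> / 80) / 2 ^ n * (\<Sum>\<sigma>\<in>assignments n. avg (formulas n k m) (?F \<sigma>))"
    by (simp only: avg_cmult avg_sum)
  also have "\<dots> \<le> exp (\<mu> / 80) / 2 ^ n * (of_nat (card (assignments n)) * exp (- (\<mu> / 40)))"
  proof (intro mult_left_mono sum_bounded_above)
    fix \<sigma>
    show "avg (formulas n k m) (?F \<sigma>) \<le> exp (- (\<mu> / 40))"
      using prob_separated_few_unsat[of n k "{\<sigma>}" m] assms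
      by (simp add: formula_prob_avg \<mu>_def)
  qed simp
  also have "exp (\<mu> / 80) / 2 ^ n * (of_nat (card (assignments n)) * exp (- (\<mu> / 40))) = exp (- (\<mu> / 80))"
    by (simp add: card_assignments flip: exp_add)
  finally show ?thesis by (simp add: \<mu>_def)
qed

text \<open>Union bound over the centre and over the \<open>k\<close>-subsets of the ball.
  Separation makes the exponent gain the factor \<open>k\<close>, and this is what can outweigh the
  \<open>2 ^ n\<close> centres when \<open>m / 2 ^ k\<close> itself is smaller than
  \<open>n\<close>.\<close>

lemma prob_clustered:
  fixes \<rho> :: real
  assumes "n > 0" "k > 0"
  shows "formula_prob n k m (\<lambda>\<Phi>. \<exists>\<sigma>\<in>assignments n. \<exists>T. T \<subseteq> low n k m \<Phi> \<inter> ball_n n \<sigma> \<rho> \<and>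
        card T = k \<and> separated n (n * ln k / k) T)
     \<le> 2 ^ n * exp (n + k * \<rho> * ln k - k * (m / 2 ^ k) / 40)"
proof -
  define \<mu> where "\<mu> = m / 2 ^ k"
  let ?Q = "\<lambda>T \<Phi>. \<forall>t\<in>T. card (unsat_clauses k m \<Phi> t) \<le> \<mu> / 2"
  let ?C = "\<lambda>\<sigma>. {T. T \<subseteq> ball_n n \<sigma> \<rho> \<and> card T = k \<and> separated n (n * ln k / k) T}"
  have finC: "finite (?C \<sigma>)" for \<sigma>
    by (rule finite_subset[of _ "Pow (ball_n n \<sigma> \<rho>)"]) (auto simp: finite_ball_n)
  have cardC: "card (?C \<sigma>) \<le> exp (n + k * \<rho> * ln k)" for \<sigma>
  proof -
    have "card (?C \<sigma>) \<le> card {T. T \<subseteq> ball_n n \<sigma> \<rho> \<and> card T = k}"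
      by (rule card_mono) (auto simp: finite_ball_n)
    also have "\<dots> = card (ball_n n \<sigma> \<rho>) choose k"
      by (rule n_subsets) (rule finite_ball_n)
    also have "\<dots> \<le> card (ball_n n \<sigma> \<rho>) ^ k"
      by (cases "k \<le> card (ball_n n \<sigma> \<rho>)") (auto simp: binomial_le_pow not_le binomial_eq_0)
    finally have "real (card (?C \<sigma>)) \<le> real (card (ball_n n \<sigma> \<rho>) ^ k)"
      by (rule of_nat_mono)
    also have "\<dots> = real (card (ball_n n \<sigma> \<rho>)) ^ k"
      by (rule of_nat_power)
    also have "\<dots> \<le> exp (n / k + \<rho> * ln k) ^ k"
      by (intro power_mono card_ball_n_le) (use assms in auto)
    also have "\<dots> = exp (n + k * \<rho> * ln k)"
      using assms by (simp add: distrib_left mult.assoc flip: exp_of_nat_mult)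
    finally show ?thesis .
  qed
  have "formula_prob n k m (\<lambda>\<Phi>. \<exists>\<sigma>\<in>assignments n. \<exists>T. T \<subseteq> low n k m \<Phi> \<inter> ball_n n \<sigma> \<rho> \<and>
        card T = k \<and> separated n (n * ln k / k) T)
      \<le> avg (formulas n k m) (\<lambda>\<Phi>. of_bool (\<exists>\<sigma>\<in>assignments n. \<exists>T\<in>?C \<sigma>. ?Q T \<Phi>))"
  proof (rule formula_prob_markov)
    fix \<Phi> assume "\<exists>\<sigma>\<in>assignments n. \<exists>T. T \<subseteq> low n k m \<Phi> \<inter> ball_n n \<sigma> \<rho> \<and>
        card T = k \<and> separated n (n * ln k / k) T"
    then obtain \<sigma> T where "\<sigma> \<in> assignments n" "T \<in> ?C \<sigma>" "T \<subseteq> low n k m \<Phi>" by blast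
    moreover from this have "?Q T \<Phi>" by (auto simp: low_def \<mu>_def)
    ultimately show "1 \<le> (of_bool (\<exists>\<sigma>\<in>assignments n. \<exists>T\<in>?C \<sigma>. ?Q T \<Phi>) :: real)" by auto
  qed simp
  also have "\<dots> \<le> (\<Sum>\<sigma>\<in>assignments n. formula_prob n k m (\<lambda>\<Phi>. \<exists>T\<in>?C \<sigma>. ?Q T \<Phi>))"
    unfolding formula_prob_avg[symmetric] by (rule formula_prob_union) (rule finite_assignments)
  also have "\<dots> \<le> of_nat (card (assignments n)) * (exp (n + k * \<rho> * ln k) * exp (- (k * \<mu> / 40)))"
  proof (rule sum_bounded_above)
    fix \<sigma>
    have "formula_prob n k m (\<lambda>\<Phi>. \<exists>T\<in>?C \<sigma>. ?Q T \<Phi>) \<le> (\<Sum>T\<in>?C \<sigma>. formula_prob n k m (?Q T))"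
      by (rule formula_prob_union) (rule finC)
    also have "\<dots> \<le> of_nat (card (?C \<sigma>)) * exp (- (k * \<mu> / 40))"
    proof (rule sum_bounded_above)
      fix T assume T: "T \<in> ?C \<sigma>"
      then have "finite T" using finite_subset[OF _ finite_ball_n] by blast
      with T show "formula_prob n k m (?Q T) \<le> exp (- (k * \<mu> / 40))"
        using prob_separated_few_unsat[of n k T m] assms by (auto simp: separated_def \<mu>_def)
    qed
    also have "\<dots> \<le> exp (n + k * \<rho> * ln k) * exp (- (k * \<mu> / 40))"
      by (intro mult_right_mono cardC) auto
    finally show "formula_prob n k m (\<lambda>\<Phi>. \<exists>T\<in>?C \<sigma>. ?Q T \<Phi>) \<le> \<dots>" .
  qed
  also have "\<dots> = 2 ^ n * exp (n + k * \<rho> * ln k - k * \<mu> / 40)"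
    by (simp add: card_assignments flip: exp_add)
  finally show ?thesis by (simp add: \<mu>_def)
qed

lemma prob_some_many_hits:
  assumes "n > 0" "k > 0"
  shows "formula_prob n k m (\<lambda>\<Phi>. \<exists>\<sigma>\<in>assignments n. \<exists>\<tau>\<in>ball_n n \<sigma> (2 * (n * ln k / k)).
        \<not> 3 * hits k m \<Phi> \<sigma> \<tau> \<le> k * (m / 2 ^ k / 2))
     \<le> 2 ^ n * (exp (n / k + 2 * (n * ln k / k) * ln k) * exp (m / 2 ^ k * sqrt k - k * (m / 2 ^ k) / 30))"
    (is "formula_prob n k m (\<lambda>\<Phi>. \<exists>\<sigma>\<in>assignments n. \<exists>\<tau>\<in>?B \<sigma>. ?Q \<sigma> \<tau> \<Phi>) \<le> 2 ^ n * (?x * ?y)")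
proof -
  have "formula_prob n k m (\<lambda>\<Phi>. \<exists>\<sigma>\<in>assignments n. \<exists>\<tau>\<in>?B \<sigma>. ?Q \<sigma> \<tau> \<Phi>)
      \<le> (\<Sum>\<sigma>\<in>assignments n. formula_prob n k m (\<lambda>\<Phi>. \<exists>\<tau>\<in>?B \<sigma>. ?Q \<sigma> \<tau> \<Phi>))"
    by (rule formula_prob_union) (rule finite_assignments)
  also have "\<dots> \<le> of_nat (card (assignments n)) * (?x * ?y)"
  proof (rule sum_bounded_above)
    fix \<sigma>
    have "formula_prob n k m (\<lambda>\<Phi>. \<exists>\<tau>\<in>?B \<sigma>. ?Q \<sigma> \<tau> \<Phi>) \<le> (\<Sum>\<tau>\<in>?B \<sigma>. formula_prob n k m (?Q \<sigma> \<tau>))"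
      by (rule formula_prob_union) (rule finite_ball_n)
    also have "\<dots> \<le> of_nat (card (?B \<sigma>)) * ?y"
      by (intro sum_bounded_above prob_many_hits assms) (auto simp: ball_n_def)
    also have "\<dots> \<le> ?x * ?y"
      by (intro mult_right_mono card_ball_n_le assms) auto
    finally show "formula_prob n k m (\<lambda>\<Phi>. \<exists>\<tau>\<in>?B \<sigma>. ?Q \<sigma> \<tau> \<Phi>) \<le> ?x * ?y" .
  qed
  finally show ?thesis by (simp add: card_assignments)
qed

section \<open>Maximal separated sets and the success probability of a fixed formula\<close>

lemma exists_maximal_separated:
  fixes L :: real
  assumes "finite M" "L \<ge> 0"
  obtains S where "S \<subseteq> M" "separated n L S" "\<And>\<sigma>. \<sigma> \<in> M \<Longrightarrow> \<exists>t\<in>S. hdist n \<sigma> t \<le> L"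
proof -
  let ?A = "{S. S \<subseteq> M \<and> separated n L S}"
  have "finite ?A" by (rule finite_subset[of _ "Pow M"]) (auto simp: \<open>finite M\<close>)
  moreover have "{} \<in> ?A" by (simp add: separated_def)
  ultimately obtain S where S: "S \<in> ?A" and max: "\<forall>T\<in>?A. S \<subseteq> T \<longrightarrow> S = T"
    using finite_has_maximal[of ?A] by auto
  have "\<exists>t\<in>S. hdist n \<sigma> t \<le> L" if "\<sigma> \<in> M" for \<sigma>
  proof (rule ccontr)
    assume far: "\<not> ?thesis"
    then have far': "\<And>t. t \<in> S \<Longrightarrow> L \<le> hdist n \<sigma> t" by (meson linear)
    then have "\<And>t. t \<in> S \<Longrightarrow> L \<le> hdist n t \<sigma>"
      by (simp only: hdist_commute[of n _ \<sigma>])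
    \<comment> \<open>A point far from all of \<open>S\<close> could be added to it. Maximality then
      puts it into \<open>S\<close>, at distance 0 from itself.\<close>
    with far' have "insert \<sigma> S \<in> ?A"
      using S that by (auto simp: separated_def)
    with max have "\<sigma> \<in> S" by blast
    moreover have "hdist n \<sigma> \<sigma> = 0" by (simp add: hdist_def)
    ultimately show False using far \<open>L \<ge> 0\<close> by force
  qed
  with S show thesis by (intro that[of S]) auto
qed

text \<open>The deterministic part: the walk bound is averaged over the uniform start for a formula
  outside the last two exceptional events. The number of low assignments enters only as a
  factor.\<close>

lemma suc_le:
  fixes L :: real
  assumes \<Phi>: "\<Phi> \<in> formulas n k m" and "k > 0" "L \<ge> 0"
    and hits: "\<And>\<sigma> t. \<sigma> \<in> assignments n \<Longrightarrow> t \<in> low n k m \<Phi> \<Longrightarrow> t \<in> ball_n n \<sigma> (2 * L) \<Longrightarrow>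
       3 * hits k m \<Phi> \<sigma> t \<le> k * (m / 2 ^ k / 2)"
    and few: "\<And>\<sigma> T. \<sigma> \<in> assignments n \<Longrightarrow> T \<subseteq> low n k m \<Phi> \<inter> ball_n n \<sigma> (2 * L + 1) \<Longrightarrow>
       card T = k \<Longrightarrow> \<not> separated n L T"
  shows "suc n k m \<Phi> \<omega> \<le>
    2 powr L * (card (low n k m \<Phi>) * exp (n / k + 2 * L * ln k) / 2 ^ n + \<omega> * (2 * real k * 2 powr (-(2*L))))"
proof -
  obtain S where S: "S \<subseteq> low n k m \<Phi>" "separated n L S"
    and cover: "\<And>\<sigma>. \<sigma> \<in> low n k m \<Phi> \<Longrightarrow> \<exists>t\<in>S. hdist n \<sigma> t \<le> L"
    using exists_maximal_separated[OF finite_low \<open>L \<ge> 0\<close>] by metis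
  have finS: "finite S" using S(1) finite_low by (rule finite_subset)
  have Sn: "S \<subseteq> assignments n" using S(1) by (auto simp: low_def)
  let ?K = "2 * real k * 2 powr (-(2*L))" and ?e = "exp (n / k + 2 * L * ln k)"
  have walk: "walk_succ k m \<Phi> \<sigma> \<omega> \<le> 2 powr L * (potential n S (2*L) \<sigma> + \<omega> * ?K)"
    if \<sigma>: "\<sigma> \<in> assignments n" for \<sigma>
  proof (rule walk_succ_le_potential[OF \<Phi> \<open>k > 0\<close> \<open>L \<ge> 0\<close> finS _ _ _ _ \<sigma>])
    show "0 \<le> m / 2 ^ k / 2" by simp
  next
    fix \<sigma> assume "\<sigma> \<in> assignments n" "card (unsat_clauses k m \<Phi> \<sigma>) \<le> m / 2 ^ k / 2"
    then show "\<exists>t\<in>S. hdist n \<sigma> t \<le> L"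
      by (intro cover) (simp add: low_def)
  next
    fix \<sigma> t assume "\<sigma> \<in> assignments n" "t \<in> S" "hdist n \<sigma> t \<le> 2 * L"
    then show "3 * hits k m \<Phi> \<sigma> t \<le> k * (m / 2 ^ k / 2)"
      using S(1) Sn by (intro hits) (auto simp: ball_n_def)
  next
    fix \<sigma> assume \<sigma>: "\<sigma> \<in> assignments n"
    let ?B = "{t\<in>S. real (hdist n \<sigma> t) \<le> 2 * L + 1}"
    show "card ?B \<le> k"
    proof (rule ccontr)
      \<comment> \<open>Separation passes to subsets, so a subset of exactly \<open>k\<close>
        elements already contradicts \<open>few\<close>.\<close>
      assume "\<not> card ?B \<le> k"
      then have "k \<le> card ?B" by simp
      then obtain T where T: "T \<subseteq> ?B" "card T = k"
        by (rule obtain_subset_with_card_n)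
      then have "separated n L T" using S(2) unfolding separated_def by blast
      moreover have "T \<subseteq> low n k m \<Phi> \<inter> ball_n n \<sigma> (2 * L + 1)"
        using T(1) S(1) Sn unfolding ball_n_def by blast
      ultimately show False using few[OF \<sigma> _ T(2)] by blast
    qed
  qed
  \<comment> \<open>Each weight is at most 1, so it suffices to count pairs \<open>\<sigma>\<close>,
    \<open>t\<close> within \<open>2 * L\<close>. Summing first over \<open>\<sigma>\<close> gives
    one ball volume per element of \<open>S\<close>.\<close>
  have pot: "(\<Sum>\<sigma>\<in>assignments n. potential n S (2*L) \<sigma>) \<le> card (low n k m \<Phi>) * ?e"
  proof -
    have "(\<Sum>\<sigma>\<in>assignments n. potential n S (2*L) \<sigma>)
        \<le> (\<Sum>\<sigma>\<in>assignments n. \<Sum>t\<in>S. of_bool (hdist n \<sigma> t \<le> 2 * L))"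
      unfolding potential_def
      by (intro sum_mono, subst sum.inter_filter[OF finS], intro sum_mono) (auto simp: power_le_one)
    also have "\<dots> = (\<Sum>t\<in>S. card (ball_n n t (2 * L)))"
      by (subst sum.swap)
        (simp add: of_bool_def sum.If_cases finite_assignments ball_n_def Int_def hdist_commute)
    also have "\<dots> \<le> of_nat (card S) * ?e"
      unfolding of_nat_sum by (intro sum_bounded_above card_ball_n_le \<open>k > 0\<close>)
    also have "\<dots> \<le> card (low n k m \<Phi>) * ?e"
      using S(1) finite_low by (intro mult_right_mono) (auto intro: card_mono)
    finally show ?thesis .
  qed
  have "(\<Sum>\<sigma>\<in>assignments n. walk_succ k m \<Phi> \<sigma> \<omega>)
      \<le> (\<Sum>\<sigma>\<in>assignments n. 2 powr L * (potential n S (2*L) \<sigma> + \<omega> * ?K))"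
    by (rule sum_mono) (rule walk)
  also have "\<dots> = 2 powr L * ((\<Sum>\<sigma>\<in>assignments n. potential n S (2*L) \<sigma>) + 2 ^ n * (\<omega> * ?K))"
    by (simp add: sum.distrib card_assignments flip: sum_distrib_left)
  also have "\<dots> \<le> 2 powr L * (card (low n k m \<Phi>) * ?e + 2 ^ n * (\<omega> * ?K))"
    using pot by (intro mult_left_mono add_right_mono) auto
  finally have "suc n k m \<Phi> \<omega> \<le> 2 powr L * (card (low n k m \<Phi>) * ?e + 2 ^ n * (\<omega> * ?K)) / 2 ^ n"
    unfolding suc_def by (intro divide_right_mono) auto
  also have "\<dots> = 2 powr L * (card (low n k m \<Phi>) * ?e / 2 ^ n + \<omega> * ?K)"
    by (simp add: add_divide_distrib distrib_left)
  finally show ?thesis .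
qed

section \<open>Numerical estimates and the choice of constants\<close>

lemma ln_3_ge: "ln 3 \<ge> (105/100 :: real)"
proof -
  have "exp (-5/100) \<ge> (95/100::real)"
    using exp_ge_add_one_self[of "-5/100::real"] by simp
  then have e: "exp (5/100) \<le> (100/95::real)"
    by (simp add: exp_minus field_simps)
  have "exp (105/100 :: real) = exp 1 * exp (5/100)"
    by (simp flip: exp_add)
  also have "\<dots> \<le> 272/100 * (100/95)"
    using e e_less_272 by (intro mult_mono) auto
  also have "\<dots> \<le> 3" by simp
  finally show ?thesis by (subst ln_ge_iff) auto
qed

text \<open>Together with \<open>ln 2 \<ge> 2/3\<close> this yields
  \<open>ln k * ln 2 \<ge> 7/10\<close>, exactly the rate at which the accumulated error has to
  decay when \<open>k = 3\<close>.\<close>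

lemma ln_ge_105:
  fixes k :: nat
  assumes "k \<ge> 3"
  shows "ln k \<ge> 105/100"
  using ln_3_ge ln_mono[of 3 "real k"] assms by linarith

text \<open>Each summand is at most half the target. The starting potential is small because
  \<open>\<mu> / 80\<close> dominates every other exponent; the accumulated error is of order
  \<open>k * \<omega> * 2 powr (- L)\<close>, and \<open>L\<close> exceeds \<open>n / k ^ 2\<close>
  by enough.\<close>

lemma suc_bound_le:
  fixes n k \<omega> :: nat and L \<mu> N :: real
  assumes k: "k \<ge> 3" and n: "n \<ge> 240 * k ^ 2" "n > 0"
    and L: "L = n * ln k / k"
    and \<mu>: "\<mu> \<ge> 288000 * (n * (ln k)\<^sup>2 / k)"
    and N0: "0 \<le> N" and N: "N \<le> 2 ^ n * exp (- (\<mu> / 80))"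
    and \<omega>: "\<omega> = nat \<lceil>exp (real n / real k ^ 2)\<rceil>"
  shows "2 powr L * (N * exp (n / k + 2 * L * ln k) / 2 ^ n + \<omega> * (2 * real k * 2 powr (-(2*L))))
    \<le> exp (- real n / real k ^ 2)"
proof -
  define l where "l = ln (real k)"
  have l: "l \<ge> 105/100" using ln_ge_105[OF k] by (simp add: l_def)
  define x where "x = real n / k"
  have k0: "real k \<ge> 3" using k by simp
  have x: "x \<ge> 240 * k"
  proof -
    have "240 * real k ^ 2 \<le> n"
      using of_nat_mono[OF n(1), where 'a = real] by simp
    then show ?thesis using k0 by (simp add: x_def le_divide_eq power2_eq_square)
  qed
  have x1: "x \<ge> 1" using x k0 by linarith
  have Lx: "L = x * l" by (simp add: L x_def l_def)
  have L_nonneg: "L \<ge> 0" using l x1 by (simp add: Lx)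
  have nk2: "real n / real k ^ 2 = x / k" by (simp add: x_def power2_eq_square)
  have xk: "x / k \<le> x / 3" using k0 x1 by (intro divide_left_mono) auto
  have ll: "1 \<le> l\<^sup>2" using l by (simp add: one_le_power)
  have l2: "l \<le> l\<^sup>2" using l by (simp add: power2_eq_square)
  have "N * exp (n / k + 2 * L * ln k) / 2 ^ n = N / 2 ^ n * exp (x + 2 * L * l)"
    by (simp add: x_def l_def)
  also have "\<dots> \<le> exp (- (\<mu> / 80)) * exp (x + 2 * L * l)"
    using N by (intro mult_right_mono) (auto simp: field_simps)
  finally have "2 powr L * (N * exp (n / k + 2 * L * ln k) / 2 ^ n)
      \<le> exp L * (exp (- (\<mu> / 80)) * exp (x + 2 * L * l))"
    using L_nonneg ln2_le_25_over_36 by (intro mult_mono) (auto simp: powr_def mult_left_le N0)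
  also have "\<dots> = exp (L + x + 2 * L * l - \<mu> / 80)"
    by (simp add: algebra_simps flip: exp_add)
  \<comment> \<open>One factor \<open>exp (- x)\<close> will supply the 1/2, the other the bound
    \<open>exp (- (x / k))\<close>.\<close>
  also have "\<dots> \<le> exp (- x + - x)"
  proof (subst exp_le_cancel_iff)
    have "x * l \<le> x * l\<^sup>2" using x1 l2 by (intro mult_left_mono) auto
    moreover have "x * 1 \<le> x * l\<^sup>2" using x1 ll by (intro mult_left_mono) auto
    moreover have "2 * L * l = 2 * (x * l\<^sup>2)" by (simp add: Lx power2_eq_square)
    moreover have "\<mu> \<ge> 288000 * (x * l\<^sup>2)" using \<mu> by (simp add: x_def l_def)
    moreover have "x * l\<^sup>2 \<ge> 0" using x1 by simp
    ultimately show "L + x + 2 * L * l - \<mu> / 80 \<le> - x + - x"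
      using Lx x1 by linarith
  qed
  also have "\<dots> = exp (- x) * exp (- x)" by (rule exp_add)
  also have "\<dots> \<le> 1/2 * exp (- (x / k))"
  proof (rule mult_mono)
    have "2 \<le> exp x" using exp_ge_add_one_self[of x] x1 by linarith
    then show "exp (- x) \<le> 1/2" by (simp add: exp_minus field_simps)
    have "x / k \<le> x" using xk x1 by linarith
    then show "exp (- x) \<le> exp (- (x / k))" by simp
  qed auto
  finally have A: "2 powr L * (N * exp (n / k + 2 * L * ln k) / 2 ^ n) \<le> 1/2 * exp (- (x / k))" .
  have L7: "7/10 * x \<le> L * ln 2"
  proof -
    have "7/10 \<le> l * ln 2"
      using mult_mono[OF l ln2_ge_two_thirds] l by simp
    then have "x * (7/10) \<le> x * (l * ln 2)" using x1 by (intro mult_left_mono) auto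
    then show ?thesis by (simp add: Lx mult_ac)
  qed
  have "1 \<le> exp (x / k)" using x1 by simp
  \<comment> \<open>Rounding up adds at most 1, which is at most \<open>exp (x / k)\<close>.\<close>
  then have \<omega>': "\<omega> \<le> 2 * exp (x / k)"
    using of_int_ceiling_le_add_one[of "exp (x / k)"] unfolding \<omega> nk2
    by (simp del: one_le_exp_iff of_int_ceiling_le_add_one)
  have "2 powr L * (\<omega> * (2 * real k * 2 powr (-(2*L)))) = 2 * real k * (\<omega> * (2 powr L * 2 powr (-(2*L))))"
    by (simp add: mult_ac)
  also have "2 powr L * 2 powr (-(2*L)) = exp (- (L * ln 2))"
    by (simp add: powr_def flip: exp_add)
  also have "2 * real k * (\<omega> * exp (- (L * ln 2))) \<le> 2 * real k * (2 * exp (x / k) * exp (- (7/10 * x)))"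
    using \<omega>' L7 by (intro mult_left_mono mult_mono) auto
  also have "\<dots> = 1/2 * (8 * real k) * exp (x / k + - (7/10 * x))"
    unfolding exp_add by simp
  also have "\<dots> \<le> 1/2 * exp (x / 30) * exp (x / k + - (7/10 * x))"
  proof (rule mult_right_mono, rule mult_left_mono)
    \<comment> \<open>The constant 240 in the hypothesis on \<open>n\<close> is
      \<open>8 * 30\<close>: a thirtieth of \<open>x\<close> absorbs the polynomial factor.\<close>
    have "8 * k \<le> x / 30" using x by simp
    also have "\<dots> \<le> exp (x / 30)" using exp_ge_add_one_self[of "x / 30"] by linarith
    finally show "8 * real k \<le> exp (x / 30)" by simp
  qed auto
  also have "\<dots> = 1/2 * exp (x / 30 + (x / k + - (7/10 * x)))"
    by (simp only: exp_add mult.assoc)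
  also have "\<dots> \<le> 1/2 * exp (- (x / k))"
  proof -
    \<comment> \<open>With \<open>x / k \<le> x / 3\<close> the budget is met exactly:
      \<open>1/30 + 1/3 + 1/3 = 7/10\<close>.\<close>
    have "x / 30 + (x / k + - (7/10 * x)) \<le> - (x / k)" using xk by linarith
    then show ?thesis by simp
  qed
  finally have B: "2 powr L * (\<omega> * (2 * real k * 2 powr (-(2*L)))) \<le> 1/2 * exp (- (x / k))" .
  have *: "- real n / real k ^ 2 = - (x / k)" by (simp add: nk2[symmetric])
  show ?thesis unfolding * distrib_left using A B by linarith
qed

text \<open>Each of the three exceptional events has probability at most
  \<open>exp (- (n / k))\<close>; outside them \<open>suc_le\<close> and \<open>suc_bound_le\<close>
  apply.\<close>

lemma prob_suc_le:
  fixes n m k :: nat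
  assumes k: "k \<ge> 3" and n: "n \<ge> 240 * k ^ 2" "n > 0"
    and \<mu>: "m / 2 ^ k \<ge> 288000 * (n * (ln k)\<^sup>2 / k)"
  shows "1 - 3 * exp (- (n / k)) \<le> formula_prob n k m
    (\<lambda>\<Phi>. suc n k m \<Phi> (nat \<lceil>exp (real n / real k ^ 2)\<rceil>) \<le> exp (- real n / real k ^ 2))"
proof -
  define \<mu> where "\<mu> = m / 2 ^ k"
  define l where "l = ln (real k)"
  define x where "x = real n / k"
  define L where "L = n * ln k / k"
  have l: "l \<ge> 1" using ln_ge_105[OF k] by (simp add: l_def)
  have ll: "1 \<le> l\<^sup>2" using l by (simp add: one_le_power)
  have k0: "real k \<ge> 3" "k > 0" using k by auto
  have Lx: "L = x * l" by (simp add: L_def x_def l_def)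
  have L0: "L \<ge> 0" using l by (simp add: Lx x_def)
  have nx: "real n = k * x" using k by (simp add: x_def)
  have x0: "x \<ge> 0" by (simp add: x_def)
  have \<mu>1: "\<mu> \<ge> 288000 * (x * l\<^sup>2)" using \<mu> by (simp add: \<mu>_def x_def l_def)
  have k\<mu>: "k * \<mu> \<ge> 288000 * (n * l\<^sup>2)"
    using mult_left_mono[OF \<mu>1, of "real k"] by (simp add: nx mult_ac)
  have xn: "x \<le> n" using k0 mult_left_mono[of 1 "real k" "real n"] by (simp add: x_def divide_le_eq)
  have nl: "n \<le> n * l\<^sup>2" using mult_left_mono[OF ll, of "real n"] by simp
  have xl: "x \<le> x * l\<^sup>2" using mult_left_mono[OF ll x0] by simp
  have two: "(2::real) ^ n \<le> exp n"
  proof -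
    have "(2::real) \<le> exp 1" using exp_ge_add_one_self[of "1::real"] by simp
    then have "(2::real) ^ n \<le> exp 1 ^ n" by (intro power_mono) auto
    then show ?thesis by (simp flip: exp_of_nat_mult)
  qed
  \<comment> \<open>The hit counts are only controlled for \<open>k \<ge> 3600\<close>, where \<open>sqrt k \<le> k / 60\<close>. For smaller \<open>k\<close> the
    negation of \<open>?A\<close> already forces \<open>low n k m \<Phi>\<close> to be empty.\<close>
  let ?A = "\<lambda>\<Phi>. \<not> card (low n k m \<Phi>) \<le> 2 ^ n * exp (- (\<mu> / 80))"
  let ?B = "\<lambda>\<Phi>. \<exists>\<sigma>\<in>assignments n. \<exists>T. T \<subseteq> low n k m \<Phi> \<inter> ball_n n \<sigma> (2 * L + 1) \<and>
        card T = k \<and> separated n L T"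
  let ?C = "\<lambda>\<Phi>. k \<ge> 3600 \<and> (\<exists>\<sigma>\<in>assignments n. \<exists>\<tau>\<in>ball_n n \<sigma> (2 * L).
        \<not> 3 * hits k m \<Phi> \<sigma> \<tau> \<le> k * (\<mu> / 2))"
  have A: "formula_prob n k m ?A \<le> exp (- x)"
  proof -
    have "formula_prob n k m ?A \<le> exp (- (\<mu> / 80))"
      unfolding \<mu>_def by (rule prob_many_low) (use n k0 in auto)
    also have "\<dots> \<le> exp (- x)" using \<mu>1 xl x0 by simp
    finally show ?thesis .
  qed
  have B: "formula_prob n k m ?B \<le> exp (- x)"
  proof -
    have "formula_prob n k m ?B \<le> 2 ^ n * exp (n + k * (2 * L + 1) * ln k - k * \<mu> / 40)"
      unfolding \<mu>_def L_def by (rule prob_clustered) (use n k0 in auto)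
    also have "\<dots> \<le> exp n * exp (n + k * (2 * L + 1) * ln k - k * \<mu> / 40)"
      using two by (intro mult_right_mono) auto
    also have "\<dots> = exp (n + (n + k * (2 * L + 1) * ln k - k * \<mu> / 40))"
      by (rule exp_add[symmetric])
    also have "\<dots> \<le> exp (- x)"
    proof (subst exp_le_cancel_iff)
      \<comment> \<open>The extra 1 in the radius \<open>2 * L + 1\<close> costs
        \<open>k * l\<close> in the exponent, which \<open>n \<ge> 240 * k ^ 2\<close>
        absorbs.\<close>
      have "l \<le> k" unfolding l_def using ln_le_minus_one[of "real k"] k0 by simp
      then have "k * l \<le> real k * k" by (intro mult_left_mono) auto
      also have "\<dots> \<le> n" using n by (simp add: power2_eq_square flip: of_nat_mult)
      finally have "k * l \<le> n" .
      moreover have "k * (2 * L + 1) * ln k = 2 * (n * l\<^sup>2) + k * l"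
        by (simp add: Lx nx l_def power2_eq_square algebra_simps)
      ultimately show "n + (n + k * (2 * L + 1) * ln k - k * \<mu> / 40) \<le> - x"
        using k\<mu> nl xn by linarith
    qed
    finally show ?thesis .
  qed
  have C: "formula_prob n k m ?C \<le> exp (- x)"
  proof (cases "k \<ge> 3600")
    case True
    have "formula_prob n k m ?C \<le> 2 ^ n * (exp (n / k + 2 * L * ln k) * exp (\<mu> * sqrt k - k * \<mu> / 30))"
      using prob_some_many_hits[of n k m] True n k0 by (simp add: \<mu>_def L_def)
    also have "\<dots> \<le> exp n * (exp (x + 2 * L * ln k) * exp (\<mu> * sqrt k - k * \<mu> / 30))"
      unfolding x_def using two by (intro mult_right_mono) auto
    also have "\<dots> = exp (n + (x + 2 * L * ln k + (\<mu> * sqrt k - k * \<mu> / 30)))"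
      by (simp only: exp_add)
    also have "\<dots> \<le> exp (- x)"
    proof (subst exp_le_cancel_iff)
      have "60 \<le> sqrt k" using True by (intro real_le_rsqrt) auto
      then have "60 * sqrt k \<le> sqrt k * sqrt k" by (intro mult_right_mono) auto
      \<comment> \<open>At least \<open>k * \<mu> / 60\<close> of the gain
        \<open>k * \<mu> / 30\<close> survives, still a large multiple of
        \<open>n * l^2\<close>.\<close>
      then have "sqrt k \<le> k / 60" by simp
      then have "\<mu> * sqrt k \<le> \<mu> * (k / 60)" by (intro mult_left_mono) (auto simp: \<mu>_def)
      then have "\<mu> * sqrt k \<le> k * \<mu> / 60" by (simp add: mult.commute)
      moreover have "2 * L * ln k = 2 * (x * l\<^sup>2)" by (simp add: Lx l_def power2_eq_square)
      moreover have "x * l\<^sup>2 \<le> n * l\<^sup>2" using xn by (intro mult_right_mono) auto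
      ultimately show "n + (x + 2 * L * ln k + (\<mu> * sqrt k - k * \<mu> / 30)) \<le> - x"
        using k\<mu> nl xn by linarith
    qed
    finally show ?thesis .
  next
    case False
    then show ?thesis by (simp add: formula_prob_def)
  qed
  have "1 - (formula_prob n k m ?A + formula_prob n k m ?B + formula_prob n k m ?C) \<le> formula_prob n k m
    (\<lambda>\<Phi>. suc n k m \<Phi> (nat \<lceil>exp (real n / real k ^ 2)\<rceil>) \<le> exp (- real n / real k ^ 2))"
  proof (rule prob_not_le_sum3[OF n(2)])
    fix \<Phi> assume \<Phi>: "\<Phi> \<in> formulas n k m" and nA: "\<not> ?A \<Phi>" and nB: "\<not> ?B \<Phi>" and nC: "\<not> ?C \<Phi>"
    let ?\<omega> = "nat \<lceil>exp (real n / real k ^ 2)\<rceil>"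
    have hits: "3 * hits k m \<Phi> \<sigma> t \<le> k * (m / 2 ^ k / 2)"
      if "\<sigma> \<in> assignments n" "t \<in> low n k m \<Phi>" "t \<in> ball_n n \<sigma> (2 * L)" for \<sigma> t
    proof (cases "k \<ge> 3600")
      case True
      then show ?thesis using nC that unfolding \<mu>_def by blast
    next
      case False
      \<comment> \<open>The constant 288000 is \<open>80 * 3600\<close>: for \<open>k < 3600\<close>
        it gives \<open>\<mu> / 80 \<ge> 3600 * x * l^2 \<ge> n\<close>.\<close>
      have "n * l\<^sup>2 \<le> 3600 * (x * l\<^sup>2)"
      proof -
        have "k * x \<le> 3600 * x" using False x0 by (intro mult_right_mono) auto
        then have "k * x * l\<^sup>2 \<le> 3600 * x * l\<^sup>2" by (rule mult_right_mono) simp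
        then show ?thesis by (simp add: nx)
      qed
      then have "n \<le> \<mu> / 80" using nl \<mu>1 by linarith
      have "real (card (low n k m \<Phi>)) \<le> 2 ^ n * exp (- (\<mu> / 80))" using nA by simp
      also have "\<dots> \<le> 2 ^ n * exp (- real n)" using \<open>n \<le> \<mu> / 80\<close> by simp
      \<comment> \<open>Strictness matters: a cardinality below 1 is 0.\<close>
      also have "\<dots> < exp n * exp (- real n)"
      proof (rule mult_strict_right_mono)
        have "(2::real) < exp 1"
          using ln2_le_25_over_36 by (subst exp_ln[of 2, symmetric]) (auto simp only: exp_less_cancel_iff)
        then have "(2::real) ^ n < exp 1 ^ n" using n by (intro power_strict_mono) auto
        then show "(2::real) ^ n < exp n" by (simp flip: exp_of_nat_mult)
      qed simp
      also have "\<dots> = 1" by (simp flip: exp_add)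
      finally have "low n k m \<Phi> = {}" using finite_low by (simp add: card_eq_0_iff)
      with that show ?thesis by simp
    qed
    have "suc n k m \<Phi> ?\<omega> \<le> 2 powr L * (card (low n k m \<Phi>) * exp (n / k + 2 * L * ln k) / 2 ^ n
        + ?\<omega> * (2 * real k * 2 powr (-(2*L))))"
      by (rule suc_le[OF \<Phi> k0(2) L0 hits]) (use nB in blast)+
    also have "\<dots> \<le> exp (- real n / real k ^ 2)"
      by (rule suc_bound_le[OF k n L_def \<mu>[folded \<mu>_def] _ _ refl]) (use nA in auto)
    finally show "suc n k m \<Phi> ?\<omega> \<le> exp (- real n / real k ^ 2)" .
  qed
  with A B C show ?thesis by (simp add: x_def)
qed

theorem theorem1:
  shows "\<exists>c::real>0. \<forall>k::nat\<ge>3. \<forall>m::nat\<Rightarrow>nat.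
    (\<forall>\<^sub>F n in sequentially. real (m n) / real n \<ge> c * 2 ^ k * (ln (real k))\<^sup>2 / real k) \<longrightarrow>
    ((\<lambda>n. formula_prob n k (m n)
        (\<lambda>\<Phi>. suc n k (m n) \<Phi> (nat \<lceil>exp (real n / real k ^ 2)\<rceil>)
               \<le> exp (- real n / real k ^ 2))) \<longlonglongrightarrow> 1)"
proof (intro exI[of _ 288000] conjI allI impI)
  fix k :: nat and m :: "nat \<Rightarrow> nat"
  assume k: "k \<ge> 3"
    and m: "\<forall>\<^sub>F n in sequentially. real (m n) / real n \<ge> 288000 * 2 ^ k * (ln (real k))\<^sup>2 / real k"
  let ?P = "\<lambda>n. formula_prob n k (m n) (\<lambda>\<Phi>. suc n k (m n) \<Phi> (nat \<lceil>exp (real n / real k ^ 2)\<rceil>)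
               \<le> exp (- real n / real k ^ 2))"
  \<comment> \<open>As \<open>k\<close> is fixed, \<open>n \<ge> 240 * k ^ 2\<close> holds for all
    large \<open>n\<close>.\<close>
  have "\<forall>\<^sub>F n in sequentially. 1 - 3 * exp (- (real n / k)) \<le> ?P n"
    using m eventually_ge_at_top[of "240 * k ^ 2"] eventually_gt_at_top[of 0]
  proof eventually_elim
    case (elim n)
    then have "real (m n) / 2 ^ k \<ge> 288000 * (n * (ln k)\<^sup>2 / k)"
      using k by (simp add: field_simps)
    with elim k show ?case by (intro prob_suc_le) auto
  qed
  moreover have "(\<lambda>n. 1 - 3 * exp (- (real n / k))) \<longlonglongrightarrow> 1"
  proof -
    have "filterlim (\<lambda>n. real n / k) at_top sequentially"
      using k by (intro filterlim_tendsto_pos_mult_at_top[OF tendsto_const _ filterlim_real_sequentially, of "1 / k", simplified]) auto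
    then have "(\<lambda>n. exp (- (real n / k))) \<longlonglongrightarrow> 0"
      by (intro filterlim_compose[OF exp_at_bot]) (simp add: filterlim_uminus_at_bot)
    from tendsto_diff[OF tendsto_const[of 1] tendsto_mult[OF tendsto_const[of 3] this]]
    show ?thesis by simp
  qed
  ultimately show "?P \<longlonglongrightarrow> 1"
    using tendsto_sandwich[of _ ?P sequentially "\<lambda>_. 1" 1] by (simp add: formula_prob_le_1)
qed simp

end
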